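(* Assume the nonexpansive case with $\sigma=1$ and a Hermitian matrix $A\in\mathbb{C}^{n\times n}$ (i.e. $\mu_2(A)\le 0$). Let $\delta_m(t)=e_m^*\,\mathrm{e}^{tT_m}e_1$. Then $$|\delta_m(t)|=\delta_m(t)>0\qquad\text{for } t>0.$$ This leads to the following upper bounds, for every integer $p\ge 0$ and $t\ge 0$, for the errors $L_m^p(t)v=\varphi_p(tA)v-V_m\varphi_p(tT_m)e_1$ and $L_m^{p,+}(t)v=\varphi_p(tA)v-V_m^+\varphi_p(tT_m^+)e_1$: $$\|L_m^p(t)v\|_2\le \tau_{m+1,m}\,t\;e_m^*\,\varphi_{p+1}(tT_m)\,e_1,\qquad e_m^*\,\varphi_{p+1}(tT_m)\,e_1\ge 0,$$ and $$\|L_m^{p,+}(t)v\|_2\le \|A v_{m+1}\|_2\,\tau_{m+1,m}\,t^2\;e_m^*\,\varphi_{p+2}(tT_m)\,e_1,\qquad e_m^*\,\varphi_{p+2}(tT_m)\,e_1\ge 0.$$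
   Context: Setting: $A\in\mathbb{C}^{n\times n}$, $v\in\mathbb{C}^n$ with $\|v\|_2=1$, and $m\ge 1$ an integer. $\mu_2$ is the logarithmic norm associated with the 2-norm; $\mu_2(A)\le 0$ is equivalent to $\mathrm{Re}(x^*Ax)\le 0$ for all $x\in\mathbb{C}^n$. Krylov decomposition: the Lanczos iteration (Arnoldi iteration for Hermitian $A$) applied to $A$ and $v$ is assumed to run until dimension $m$ without breakdown (i.e. $v,Av,\dots,A^m v$ are linearly independent). It yields a matrix $V_m\in\mathbb{C}^{n\times m}$ with $V_m^*V_m=I$ whose columns span $\mathcal{K}_m(A,v)=\mathrm{span}\{v,Av,\dots,A^{m-1}v\}$ and whose first column is $v$ (so $V_me_1=v$), a real symmetric tridiagonal matrix $T_m=V_m^*AV_m\in\mathbb{R}^{m\times m}$ with positive lower diagonal entries $(T_m)_{j+1,j}>0$, a number $\tau_{m+1,m}>0$ and a vector $v_{m+1}\in\mathbb{C}^n$ with $\|v_{m+1}\|_2=1$, $V_m^*v_{m+1}=0$, such that $$A V_m = V_mT_m + \tau_{m+1,m}\,v_{m+1}e_m^*.$$ Here $e_1$ denotes the first unit vector (of $\mathbb{C}^m$ or $\mathbb{C}^{m+1}$, as dimensions require) and $e_m=(0,\dots,0,1)^*\in\mathbb{C}^m$. The $\varphi$-functions are $\varphi_p(z)=\sum_{k=0}^\infty \frac{z^k}{(k+p)!}$ for integers $p\ge 0$ (so $\varphi_0(z)=\mathrm{e}^z$), applied to matrices via the power series. The corrected Krylov approximation uses $$T_m^+=\begin{bmatrix}T_m&0\\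 \tau_{m+1,m}e_m^*&0\end{bmatrix}\in\mathbb{C}^{(m+1)\times(m+1)},\qquad V_m^+=[\,V_m\,|\,v_{m+1}\,]\in\mathbb{C}^{n\times(m+1)}.$$ *)

theory Defs
  imports "HOL-Analysis.Analysis" "Jordan_Normal_Form.Schur_Decomposition"
begin

text \<open>
  Vectors and matrices carry their dimensions at run time, so that \<open>m\<close> and \<open>m + 1\<close> can occur
  together, and indices start at 0: the first unit vector of \<open>\<complex>\<^sup>m\<close> is \<open>unit_vec m 0\<close> and the last one
  is \<open>unit_vec m (m - 1)\<close>. On \<open>complex\<close> the order is the one of \<^theory>\<open>HOL-Library.Complex_Order\<close>:
  \<open>x \<le> y\<close> includes that the imaginary parts agree, so \<open>0 < z\<close> says that \<open>z\<close> is real and positive.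
\<close>

definition vec_norm2 :: "complex Matrix.vec \<Rightarrow> real" where
  "vec_norm2 x = L2_set (\<lambda>i. cmod (vec_index x i)) {..<dim_vec x}"

definition mat_norm2 :: "complex mat \<Rightarrow> real" where
  "mat_norm2 M = (SUP x\<in>{x \<in> carrier_vec (dim_col M). vec_norm2 x \<le> 1}. vec_norm2 (M *\<^sub>v x))"

text \<open>
  The limit exists for every square matrix: the difference quotient of the convex function
  \<open>h \<mapsto> \<parallel>I + h M\<parallel>\<^sub>2\<close> is monotone in \<open>h > 0\<close> and bounded from below by \<open>- \<parallel>M\<parallel>\<^sub>2\<close>.
\<close>

definition log_norm2 :: "complex mat \<Rightarrow> real" where
  "log_norm2 M = Lim (at_right 0)
     (\<lambda>h. (mat_norm2 (1\<^sub>m (dim_row M) + complex_of_real h \<cdot>\<^sub>m M) - 1) / h)"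

definition mat_power_series :: "(nat \<Rightarrow> complex) \<Rightarrow> complex mat \<Rightarrow> complex mat" where
  "mat_power_series c M =
     mat (dim_row M) (dim_col M) (\<lambda>(i, j). \<Sum>k. c k * (M ^\<^sub>m k) $$ (i, j))"

definition mat_exp :: "complex mat \<Rightarrow> complex mat" where
  "mat_exp = mat_power_series (\<lambda>k. 1 / fact k)"

definition mat_phi :: "nat \<Rightarrow> complex mat \<Rightarrow> complex mat" where
  "mat_phi p = mat_power_series (\<lambda>k. 1 / fact (k + p))"

definition krylov_vecs :: "complex mat \<Rightarrow> complex Matrix.vec \<Rightarrow> nat \<Rightarrow> complex Matrix.vec list" where
  "krylov_vecs A v k = map (\<lambda>j. (A ^\<^sub>m j) *\<^sub>v v) [0..<k]"

text \<open>
  \<open>V\<close>, \<open>T\<close>, \<open>\<tau>\<close>, \<open>w\<close> stand for \<open>V\<^sub>m\<close>, \<open>T\<^sub>m\<close>, \<open>\<tau>\<^bsub>m+1,m\<^esub>\<close>, \<open>v\<^bsub>m+1\<^esub>\<close>. The first two conjuncts after the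
  dimensions say that \<open>v, A v, \<dots>, A\<^sup>m v\<close> is a linearly independent family.
\<close>

definition lanczos_decomposition ::
  "nat \<Rightarrow> nat \<Rightarrow> complex mat \<Rightarrow> complex Matrix.vec \<Rightarrow>
   complex mat \<Rightarrow> complex mat \<Rightarrow> real \<Rightarrow> complex Matrix.vec \<Rightarrow> bool" where
  "lanczos_decomposition n m A v V T \<tau> w \<longleftrightarrow>
     V \<in> carrier_mat n m \<and> T \<in> carrier_mat m m \<and> w \<in> carrier_vec n \<and>
     distinct (krylov_vecs A v (m + 1)) \<and>
     \<not> LinearCombinations.module.lin_dep class_ring (module_vec TYPE(complex) n)
         (set (krylov_vecs A v (m + 1))) \<and>
     mat_adjoint V * V = 1\<^sub>m m \<and>
     LinearCombinations.module.span class_ring (module_vec TYPE(complex) n) (set (cols V)) =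
       LinearCombinations.module.span class_ring (module_vec TYPE(complex) n)
         (set (krylov_vecs A v m)) \<and>
     V *\<^sub>v unit_vec m 0 = v \<and>
     T = mat_adjoint V * A * V \<and>
     (\<forall>i<m. \<forall>j<m. T $$ (i, j) \<in> \<real>) \<and>
     transpose_mat T = T \<and>
     (\<forall>i<m. \<forall>j<m. i + 1 < j \<or> j + 1 < i \<longrightarrow> T $$ (i, j) = 0) \<and>
     (\<forall>j. j + 1 < m \<longrightarrow> 0 < T $$ (j + 1, j)) \<and>
     0 < \<tau> \<and>
     vec_norm2 w = 1 \<and>
     mat_adjoint V *\<^sub>v w = 0\<^sub>v m \<and>
     A * V = V * T +
       complex_of_real \<tau> \<cdot>\<^sub>m (mat_of_cols n [w] * mat_of_rows m [unit_vec m (m - 1)])"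

definition extended_T :: "nat \<Rightarrow> complex mat \<Rightarrow> real \<Rightarrow> complex mat" where
  "extended_T m T \<tau> =
     four_block_mat T (0\<^sub>m m 1)
       (complex_of_real \<tau> \<cdot>\<^sub>m mat_of_rows m [unit_vec m (m - 1)]) (0\<^sub>m 1 1)"

definition extended_V :: "nat \<Rightarrow> complex mat \<Rightarrow> complex Matrix.vec \<Rightarrow> complex mat" where
  "extended_V n V w = mat_of_cols n (cols V @ [w])"

text \<open>The scalar \<open>e\<^sub>m\<^sup>* M e\<^sub>1\<close>; the product \<open>\<bullet>c\<close> conjugates its second argument.\<close>

definition last_first :: "nat \<Rightarrow> complex mat \<Rightarrow> complex" where
  "last_first m M = (M *\<^sub>v unit_vec m 0) \<bullet>c unit_vec m (m - 1)"

definition krylov_defect :: "nat \<Rightarrow> complex mat \<Rightarrow> real \<Rightarrow> complex" where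
  "krylov_defect m T t = last_first m (mat_exp (complex_of_real t \<cdot>\<^sub>m T))"

definition krylov_error ::
  "nat \<Rightarrow> nat \<Rightarrow> complex mat \<Rightarrow> complex Matrix.vec \<Rightarrow> complex mat \<Rightarrow> complex mat \<Rightarrow>
   real \<Rightarrow> complex Matrix.vec" where
  "krylov_error p m A v V T t =
     mat_phi p (complex_of_real t \<cdot>\<^sub>m A) *\<^sub>v v
       - V *\<^sub>v (mat_phi p (complex_of_real t \<cdot>\<^sub>m T) *\<^sub>v unit_vec m 0)"

definition corrected_krylov_error ::
  "nat \<Rightarrow> nat \<Rightarrow> nat \<Rightarrow> complex mat \<Rightarrow> complex Matrix.vec \<Rightarrow> complex mat \<Rightarrow> complex mat \<Rightarrow>
   real \<Rightarrow> complex Matrix.vec \<Rightarrow> real \<Rightarrow> complex Matrix.vec" where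
  "corrected_krylov_error p n m A v V T \<tau> w t =
     krylov_error p (m + 1) A v (extended_V n V w) (extended_T m T \<tau>) t"

end

theory Submission
  imports Defs
begin

text \<open>
  Write \<open>e\<close> for the first unit vector and \<open>E\<^sub>p(t) = t\<^sup>p L\<^sup>p(t) v\<close> for the error scaled by \<open>t\<^sup>p\<close>. The scaling makes the
  family of phi functions uniform in \<open>p\<close>: \<open>t\<^sup>p \<phi>\<^sub>p(tA)\<close> is the \<open>p\<close>-fold iterated integral of \<open>exp(tA)\<close>,
  so \<open>t \<mapsto> t\<^bsup>p+1\<^esup> \<phi>\<^bsub>p+1\<^esub>(tA)\<close> has derivative \<open>t\<^sup>p \<phi>\<^sub>p(tA)\<close>. With the defect
  \<open>\<delta>\<^sub>p(t) = t\<^sup>p e\<^sub>m\<^sup>* \<phi>\<^sub>p(tT) e\<close> the Krylov relation \<open>A V = V T + \<tau> w e\<^sub>m\<^sup>*\<close> turns into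

    \<open>E\<^sub>p' = A E\<^sub>p + \<tau> \<delta>\<^sub>p w\<close>,  \<open>E\<^sub>p(0) = 0\<close>,

  because the starting vectors agree (\<open>V e = v\<close>), so that the polynomial part of the equation for
  \<open>t\<^sup>p \<phi>\<^sub>p\<close> cancels. Since \<open>Re(x\<^sup>* A x) \<le> 0\<close>, the norm of \<open>E\<^sub>p\<close> grows at most at the rate
  \<open>\<tau> \<bar>\<delta>\<^sub>p\<bar>\<close>. If \<open>\<delta>\<^sub>p \<ge> 0\<close>, the integral of this rate is exactly \<open>\<tau> \<delta>\<^bsub>p+1\<^esub>\<close>, and dividing by
  \<open>t\<^sup>p\<close> gives the bound. This is \<open>krylov_error_bound\<close>, which rests on the comparison argument \<open>norm_growth_bound\<close>.

  The corrected approximation satisfies a relation of the same shape,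
  \<open>A V\<^sup>+ = V\<^sup>+ T\<^sup>+ + (A w) e\<^bsub>m+1\<^esub>\<^sup>*\<close>, so the same lemma applies. The last row of \<open>T\<^sup>+\<close> only
  reads off \<open>\<tau>\<close> times the last component of the \<open>T\<close> block, delayed by one power, so the new defect is
  \<open>\<tau> \<delta>\<^bsub>p+1\<^esub>\<close> (\<open>last_first_phi_extended_T\<close>); this raises the order in \<open>t\<close> by one.

  Positivity of \<open>\<delta>\<^sub>0\<close> comes from the tridiagonal structure. For large \<open>c\<close> the matrix \<open>T + c I\<close> is entrywise
  nonnegative with positive subdiagonal, so every term of its exponential series is nonnegative, and the term
  with the \<open>(m-1)\<close>-st power is positive in the corner \<open>(m, 1)\<close>, reached along the subdiagonal; the factor \<open>exp(-ct)\<close> undoes the shift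
  (\<open>phi_series_last_entry_pos\<close>). Integrating \<open>p\<close> times gives \<open>\<delta>\<^sub>p \<ge> 0\<close>.

  Finally, \<open>log_norm2\<close> is defined as a limit, so its sign carries information only once the limit is known to
  exist. The difference quotients are monotone and bounded below by \<open>Re(x\<^sup>* A x)\<close> for each unit vector \<open>x\<close>; both
  existence and dissipativity follow (\<open>dissipative_if_log_norm2_nonpos\<close>).
\<close>

unbundle no vec_syntax and no inner_syntax

section \<open>Scalar phi series\<close>

text \<open>
  All matrix functions below are reduced to this series: an entry of \<open>\<phi>\<^sub>p(z M) x\<close> is \<open>phi_series p c z\<close> with
  \<open>c k\<close> the same entry of \<open>M\<^sup>k x\<close>, and these coefficients are geometrically bounded.
\<close>

definition phi_series :: "nat \<Rightarrow> (nat \<Rightarrow> 'a) \<Rightarrow> 'a \<Rightarrow> 'a::{real_normed_field, banach}" where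
  "phi_series p c z = (\<Sum>k. c k * z ^ k / fact (k + p))"

definition geom_bounded :: "(nat \<Rightarrow> 'a::real_normed_vector) \<Rightarrow> bool" where
  "geom_bounded c \<longleftrightarrow> (\<exists>K B. \<forall>k. norm (c k) \<le> K * B ^ k)"

lemma geom_bounded_shift: "geom_bounded c \<Longrightarrow> geom_bounded (\<lambda>k. c (Suc k))"
  unfolding geom_bounded_def
proof (elim exE)
  fix K B assume "\<forall>k. norm (c k) \<le> K * B ^ k"
  then have "norm (c (Suc k)) \<le> (K * B) * B ^ k" for k
    by (metis mult.assoc power_Suc)
  then show "\<exists>K B. \<forall>k. norm (c (Suc k)) \<le> K * B ^ k" by (intro exI allI)
qed

lemma geom_bounded_add:
  assumes "geom_bounded c" "geom_bounded d"
  shows "geom_bounded (\<lambda>k. c k + d k)"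
proof -
  obtain K B where 1: "\<And>k. norm (c k) \<le> K * B ^ k" using assms(1) unfolding geom_bounded_def by blast
  obtain L C where 2: "\<And>k. norm (d k) \<le> L * C ^ k" using assms(2) unfolding geom_bounded_def by blast
  let ?M = "max \<bar>B\<bar> \<bar>C\<bar>"
  have "norm (c k + d k) \<le> (\<bar>K\<bar> + \<bar>L\<bar>) * ?M ^ k" for k
  proof -
    have "K * B ^ k \<le> \<bar>K\<bar> * ?M ^ k"
      by (rule order_trans[OF abs_ge_self]) (auto simp: abs_mult power_abs intro!: mult_left_mono power_mono)
    moreover have "L * C ^ k \<le> \<bar>L\<bar> * ?M ^ k"
      by (rule order_trans[OF abs_ge_self]) (auto simp: abs_mult power_abs intro!: mult_left_mono power_mono)
    ultimately show ?thesis
      using norm_triangle_ineq[of "c k" "d k"] 1[of k] 2[of k] unfolding distrib_right by linarith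
  qed
  then show ?thesis unfolding geom_bounded_def by (intro exI allI)
qed

lemma geom_bounded_mult_left:
  fixes c :: "nat \<Rightarrow> 'a::real_normed_field"
  assumes "geom_bounded c"
  shows "geom_bounded (\<lambda>k. a * c k)"
proof -
  obtain K B where 1: "\<And>k. norm (c k) \<le> K * B ^ k" using assms unfolding geom_bounded_def by blast
  have "norm (a * c k) \<le> (norm a * K) * B ^ k" for k
    unfolding norm_mult mult.assoc by (rule mult_left_mono[OF 1 norm_ge_zero])
  then show ?thesis unfolding geom_bounded_def by (intro exI allI)
qed

lemma geom_bounded_sum:
  fixes c :: "'b \<Rightarrow> nat \<Rightarrow> 'a::real_normed_field"
  assumes "finite J" "\<And>j. j \<in> J \<Longrightarrow> geom_bounded (c j)"
  shows "geom_bounded (\<lambda>k. \<Sum>j\<in>J. a j * c j k)"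
  using assms
proof (induction J rule: finite_induct)
  case empty
  show ?case unfolding geom_bounded_def by (rule exI[of _ 0]) simp
next
  case (insert j J)
  then show ?case by (simp add: geom_bounded_add geom_bounded_mult_left)
qed

lemma phi_series_summable_norm:
  fixes c :: "nat \<Rightarrow> 'a::{real_normed_field, banach}"
  assumes "geom_bounded c"
  shows "summable (\<lambda>k. norm (c k * z ^ k / fact (k + p)))"
proof -
  obtain K B where KB: "\<And>k. norm (c k) \<le> K * B ^ k"
    using assms unfolding geom_bounded_def by blast
  have "summable (\<lambda>k. \<bar>K\<bar> * ((\<bar>B\<bar> * norm z) ^ k /\<^sub>R fact k))"
    by (intro summable_mult summable_exp_generic)
  moreover have "norm (norm (c k * z ^ k / fact (k + p))) \<le> \<bar>K\<bar> * ((\<bar>B\<bar> * norm z) ^ k /\<^sub>R fact k)" for k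
  proof -
    have "norm (c k) \<le> \<bar>K\<bar> * \<bar>B\<bar> ^ k"
      using order_trans[OF KB[of k] abs_ge_self] by (simp only: abs_mult power_abs)
    then have "norm (c k) * norm z ^ k \<le> (\<bar>K\<bar> * \<bar>B\<bar> ^ k) * norm z ^ k"
      by (intro mult_right_mono) auto
    moreover have "(fact k :: real) \<le> fact (k + p)"
      by (rule fact_mono) simp
    ultimately have "norm (c k) * norm z ^ k / fact (k + p) \<le> (\<bar>K\<bar> * \<bar>B\<bar> ^ k) * norm z ^ k / fact k"
      by (intro frac_le) auto
    then show ?thesis
      by (simp add: norm_mult norm_divide norm_power power_mult_distrib divide_inverse[of _ "fact k"] mult_ac)
  qed
  ultimately show ?thesis
    by (rule summable_comparison_test'[where N = 0])
qed

lemmas phi_series_summable = summable_norm_cancel[OF phi_series_summable_norm]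

lemma phi_series_0: "phi_series p c 0 = c 0 / fact p"
proof -
  have "phi_series p c 0 = (\<Sum>k. (c k / fact (k + p)) * 0 ^ k)"
    by (simp add: phi_series_def)
  then show ?thesis by (simp only: powser_zero) simp
qed

text \<open>
  The counterpart of \<open>\<phi>\<^sub>p(z) = 1/p! + z \<phi>\<^bsub>p+1\<^esub>(z)\<close>. For \<open>c k\<close> an entry of \<open>M\<^sup>k x\<close>,
  shifting the coefficients replaces \<open>x\<close> by \<open>M x\<close>.
\<close>

lemma phi_series_unfold:
  assumes "geom_bounded c"
  shows "phi_series p c z = c 0 / fact p + z * phi_series (Suc p) (\<lambda>k. c (Suc k)) z"
proof -
  have "phi_series p c z = (\<Sum>k. c (Suc k) * z ^ Suc k / fact (Suc k + p)) + c 0 / fact p"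
    unfolding phi_series_def using suminf_split_head[OF phi_series_summable[OF assms, of z p]] by simp
  also have "(\<Sum>k. c (Suc k) * z ^ Suc k / fact (Suc k + p))
      = (\<Sum>k. z * (c (Suc k) * z ^ k / fact (k + Suc p)))"
    by (simp add: mult_ac)
  also have "\<dots> = z * phi_series (Suc p) (\<lambda>k. c (Suc k)) z"
    unfolding phi_series_def
    by (rule suminf_mult[OF phi_series_summable[OF geom_bounded_shift[OF assms]]])
  finally show ?thesis by simp
qed

text \<open>
  The product is \<open>\<Sum>k. c k z\<^bsup>k+p+1\<^esup> / (k+p+1)!\<close>, whose terms differentiate to those for \<open>p\<close>. To use termwise
  differentiation of power series the factor \<open>z\<^bsup>p+1\<^esup>\<close> is split off, and the product rule puts it back.
\<close>

lemma phi_series_has_derivative: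
  assumes "geom_bounded c"
  shows "((\<lambda>z. z ^ Suc p * phi_series (Suc p) c z) has_field_derivative z ^ p * phi_series p c z) (at z)"
proof -
  define a where "a k = c k / fact (k + Suc p)" for k
  have a: "phi_series (Suc p) c = (\<lambda>z. \<Sum>k. a k * z ^ k)"
    by (rule ext) (simp add: phi_series_def a_def)
  have sm: "summable (\<lambda>k. a k * y ^ k)" for y
    using phi_series_summable[OF assms, of y "Suc p"] by (simp add: a_def)
  have D: "((\<lambda>z. \<Sum>k. a k * z ^ k) has_field_derivative (\<Sum>k. diffs a k * z ^ k)) (at z)"
    by (rule termdiffs_strong_converges_everywhere[OF sm])
  have sd: "summable (\<lambda>k. diffs a k * z ^ k)"
    by (rule termdiff_converges_all[OF sm])
  have "(\<lambda>k. of_nat (Suc k) * a (Suc k) * z ^ Suc k) sums (z * (\<Sum>k. diffs a k * z ^ k))"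
    using sums_mult[OF summable_sums[OF sd], of z] by (simp add: diffs_def mult_ac)
  then have 1: "(\<lambda>k. of_nat k * a k * z ^ k) sums (z * (\<Sum>k. diffs a k * z ^ k))"
    by (subst (asm) sums_Suc_iff) simp
  have 2: "(\<lambda>k. of_nat (Suc p) * (a k * z ^ k)) sums (of_nat (Suc p) * (\<Sum>k. a k * z ^ k))"
    by (intro sums_mult summable_sums sm)
  have "of_nat k * a k * z ^ k + of_nat (Suc p) * (a k * z ^ k) = c k * z ^ k / fact (k + p)" for k
  proof -
    have "(fact (k + Suc p) :: 'a) = of_nat (k + Suc p) * fact (k + p)"
      by (simp only: add_Suc_right fact_Suc)
    moreover have "of_nat (k + Suc p) \<noteq> (0::'a)" by (simp only: of_nat_eq_0_iff)
    ultimately have "of_nat (k + Suc p) * a k = c k / fact (k + p)"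
      unfolding a_def by (simp del: of_nat_add of_nat_Suc)
    moreover have "of_nat k * a k * z ^ k + of_nat (Suc p) * (a k * z ^ k) = (of_nat (k + Suc p) * a k) * z ^ k"
      by (simp add: algebra_simps)
    ultimately show ?thesis by simp
  qed
  then have "phi_series p c z = z * (\<Sum>k. diffs a k * z ^ k) + of_nat (Suc p) * (\<Sum>k. a k * z ^ k)"
    using sums_unique[OF sums_add[OF 1 2]] by (simp only: phi_series_def)
  then show ?thesis
    unfolding a
    using DERIV_mult[OF DERIV_power_Suc[OF DERIV_ident, of p] D] by (simp add: algebra_simps)
qed

text \<open>
  When \<open>c 0 = 0\<close> the inhomogeneity \<open>c 0 z\<^bsup>p-1\<^esup> / (p-1)!\<close> disappears, and the case \<open>p = 0\<close> no longer
  differs from the others. The Krylov error is of this kind.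
\<close>

lemma phi_series_derivative_rec:
  assumes "geom_bounded c" "c 0 = 0"
  shows "((\<lambda>z. z ^ p * phi_series p c z) has_field_derivative z ^ p * phi_series p (\<lambda>k. c (Suc k)) z) (at z)"
proof -
  have "(\<lambda>z. z ^ p * phi_series p c z) = (\<lambda>z. z ^ Suc p * phi_series (Suc p) (\<lambda>k. c (Suc k)) z)"
    by (rule ext) (subst phi_series_unfold[OF assms(1)], simp add: assms(2) mult_ac)
  then show ?thesis
    using phi_series_has_derivative[OF geom_bounded_shift[OF assms(1)]] by simp
qed

lemma phi_series_sums:
  assumes "geom_bounded c"
  shows "(\<lambda>k. c k * z ^ k / fact (k + p)) sums phi_series p c z"
  unfolding phi_series_def using summable_sums[OF phi_series_summable[OF assms, of z p]] .

lemma phi_series_mult_left: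
  assumes "geom_bounded c"
  shows "phi_series p (\<lambda>k. a * c k) z = a * phi_series p c z"
proof -
  have "(\<lambda>k. (a * c k) * z ^ k / fact (k + p)) sums (a * phi_series p c z)"
    using sums_mult[OF phi_series_sums[OF assms, of z p], of a] by (simp only: mult.assoc times_divide_eq_right)
  then show ?thesis unfolding phi_series_def[of p "\<lambda>k. a * c k"] by (rule sums_unique[symmetric])
qed

lemma phi_series_add:
  assumes "geom_bounded c" "geom_bounded d"
  shows "phi_series p (\<lambda>k. c k + d k) z = phi_series p c z + phi_series p d z"
proof -
  have "(\<lambda>k. (c k + d k) * z ^ k / fact (k + p)) sums (phi_series p c z + phi_series p d z)"
    using sums_add[OF phi_series_sums[OF assms(1), of z p] phi_series_sums[OF assms(2), of z p]]
    by (simp only: distrib_right add_divide_distrib)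
  then show ?thesis unfolding phi_series_def[of p "\<lambda>k. c k + d k"] by (rule sums_unique[symmetric])
qed

lemma phi_series_sum:
  "(\<And>j. j \<in> J \<Longrightarrow> geom_bounded (c j)) \<Longrightarrow>
    phi_series p (\<lambda>k. \<Sum>j\<in>J. a j * c j k) z = (\<Sum>j\<in>J. a j * phi_series p (c j) z)"
proof -
  assume c: "\<And>j. j \<in> J \<Longrightarrow> geom_bounded (c j)"
  have "(\<lambda>k. \<Sum>j\<in>J. a j * (c j k * z ^ k / fact (k + p))) sums (\<Sum>j\<in>J. a j * phi_series p (c j) z)"
    by (intro sums_sum sums_mult phi_series_sums[OF c])
  then have "(\<Sum>j\<in>J. a j * phi_series p (c j) z) = (\<Sum>k. \<Sum>j\<in>J. a j * (c j k * z ^ k / fact (k + p)))"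
    by (rule sums_unique)
  also have "\<dots> = phi_series p (\<lambda>k. \<Sum>j\<in>J. a j * c j k) z"
    unfolding phi_series_def by (simp add: sum_divide_distrib sum_distrib_right mult.assoc)
  finally show ?thesis by simp
qed

lemma phi_series_of_real:
  assumes "geom_bounded c"
  shows "phi_series p (\<lambda>k. complex_of_real (c k)) (complex_of_real s) = complex_of_real (phi_series p c s)"
proof -
  have "(\<lambda>k. complex_of_real (c k) * complex_of_real s ^ k / fact (k + p)) sums complex_of_real (phi_series p c s)"
    using sums_of_real[OF phi_series_sums[OF assms, of s p], where 'a = complex] by simp
  then show ?thesis
    unfolding phi_series_def[of p "\<lambda>k. complex_of_real (c k)"] by (rule sums_unique[symmetric])
qed

section \<open>Entries of phi functions of matrices\<close>

lemma pow_mat_Suc_mult_vec: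
  fixes M :: "'a::comm_semiring_1 mat"
  assumes M: "M \<in> carrier_mat n n" and x: "x \<in> carrier_vec n"
  shows "(M ^\<^sub>m Suc k) *\<^sub>v x = M *\<^sub>v ((M ^\<^sub>m k) *\<^sub>v x)"
proof -
  have "M ^\<^sub>m Suc k = M * M ^\<^sub>m k"
  proof (induction k)
    case (Suc k)
    have "M ^\<^sub>m Suc (Suc k) = M ^\<^sub>m Suc k * M" by (simp only: pow_mat.simps)
    also have "\<dots> = M * M ^\<^sub>m k * M" by (simp only: Suc)
    also have "\<dots> = M * M ^\<^sub>m Suc k" using M by (simp add: assoc_mult_mat[of _ n n _ n _ n])
    finally show ?case .
  qed (use M in simp)
  then show ?thesis
    using M x by (simp add: assoc_mult_mat_vec[of M n n "M ^\<^sub>m k" n])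
qed

lemma mult_mat_vec_index:
  assumes "M \<in> carrier_mat n k" "x \<in> carrier_vec k" "i < n"
  shows "(M *\<^sub>v x) $ i = (\<Sum>j<k. M $$ (i, j) * x $ j)"
  using assms by (auto simp: scalar_prod_def lessThan_atLeast0 intro!: sum.cong)

lemma pow_smult_mat:
  fixes M :: "'a::comm_semiring_1 mat"
  assumes "M \<in> carrier_mat n n"
  shows "(z \<cdot>\<^sub>m M) ^\<^sub>m k = z ^ k \<cdot>\<^sub>m M ^\<^sub>m k"
proof (induction k)
  case (Suc k)
  have "(z \<cdot>\<^sub>m M) ^\<^sub>m Suc k = (z ^ k \<cdot>\<^sub>m M ^\<^sub>m k) * (z \<cdot>\<^sub>m M)" by (simp add: Suc)
  also have "\<dots> = z ^ Suc k \<cdot>\<^sub>m M ^\<^sub>m Suc k"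
    using assms by (intro eq_matI) (auto simp: scalar_prod_def sum_distrib_left mult_ac)
  finally show ?case .
qed (use assms in \<open>auto\<close>)

lemma geom_bounded_pow_mat_vec:
  fixes M :: "complex mat"
  assumes M: "M \<in> carrier_mat n n" and x: "x \<in> carrier_vec n" and i: "i < n"
  shows "geom_bounded (\<lambda>k. ((M ^\<^sub>m k) *\<^sub>v x) $ i)"
proof -
  define K where "K = (\<Sum>i<n. cmod (x $ i))"
  define B where "B = (\<Sum>i<n. \<Sum>j<n. cmod (M $$ (i, j)))"
  have K: "0 \<le> K" and B: "0 \<le> B" by (auto simp: K_def B_def intro!: sum_nonneg)
  have "\<forall>i<n. cmod (((M ^\<^sub>m k) *\<^sub>v x) $ i) \<le> K * B ^ k" for k
  proof (induction k)
    case 0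
    have "cmod (x $ i) \<le> K" if "i < n" for i
      unfolding K_def by (rule member_le_sum) (use that in auto)
    then show ?case using M x by simp
  next
    case (Suc k)
    let ?y = "(M ^\<^sub>m k) *\<^sub>v x"
    have y: "?y \<in> carrier_vec n" by (rule mult_mat_vec_carrier[OF pow_carrier_mat[OF M] x])
    show ?case
    proof (intro allI impI)
      fix i assume i: "i < n"
      have "((M ^\<^sub>m Suc k) *\<^sub>v x) $ i = (\<Sum>j<n. M $$ (i, j) * ?y $ j)"
        using mult_mat_vec_index[OF M y i] pow_mat_Suc_mult_vec[OF M x] by simp
      also have "cmod \<dots> \<le> (\<Sum>j<n. cmod (M $$ (i, j)) * (K * B ^ k))"
      proof (rule order_trans[OF norm_sum], rule sum_mono)
        fix j assume "j \<in> {..<n}"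
        then have "cmod (?y $ j) \<le> K * B ^ k" using Suc by simp
        then show "cmod (M $$ (i, j) * ?y $ j) \<le> cmod (M $$ (i, j)) * (K * B ^ k)"
          unfolding norm_mult by (rule mult_left_mono) simp
      qed
      also have "\<dots> = (\<Sum>j<n. cmod (M $$ (i, j))) * (K * B ^ k)"
        by (simp add: sum_distrib_right)
      also have "\<dots> \<le> B * (K * B ^ k)"
      proof (rule mult_right_mono)
        show "(\<Sum>j<n. cmod (M $$ (i, j))) \<le> B"
          unfolding B_def by (rule member_le_sum) (use i in \<open>auto intro!: sum_nonneg\<close>)
        show "0 \<le> K * B ^ k" using K B by simp
      qed
      finally show "cmod (((M ^\<^sub>m Suc k) *\<^sub>v x) $ i) \<le> K * B ^ Suc k" by (simp add: mult_ac)
    qed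
  qed
  then show ?thesis using i unfolding geom_bounded_def by auto
qed

text \<open>
  The bridge from matrix functions to scalar series: everything later is stated for the coefficient
  sequences \<open>M\<^sup>k x\<close>.
\<close>

lemma mat_phi_mult_vec_index:
  assumes M: "M \<in> carrier_mat n n" and x: "x \<in> carrier_vec n" and i: "i < n"
  shows "(mat_phi p (z \<cdot>\<^sub>m M) *\<^sub>v x) $ i = phi_series p (\<lambda>k. ((M ^\<^sub>m k) *\<^sub>v x) $ i) z"
proof -
  have Mk: "M ^\<^sub>m k \<in> carrier_mat n n" for k using M by simp
  have E: "geom_bounded (\<lambda>k. (M ^\<^sub>m k) $$ (i, j))" if "j < n" for j
  proof -
    have "(M ^\<^sub>m k) $$ (i, j) = ((M ^\<^sub>m k) *\<^sub>v unit_vec n j) $ i" for k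
      using mult_mat_vec_index[OF Mk, of "unit_vec n j" i k] i that
      by (simp add: unit_vec_def if_distrib cong: if_cong)
    then show ?thesis using geom_bounded_pow_mat_vec[OF M _ i, of "unit_vec n j"] by simp
  qed
  have phi: "mat_phi p (z \<cdot>\<^sub>m M) \<in> carrier_mat n n"
    using M by (simp add: mat_phi_def mat_power_series_def)
  have "mat_phi p (z \<cdot>\<^sub>m M) $$ (i, j) = phi_series p (\<lambda>k. (M ^\<^sub>m k) $$ (i, j)) z" if "j < n" for j
    using M Mk i that
    by (simp add: mat_phi_def mat_power_series_def pow_smult_mat[OF M] phi_series_def mult_ac)
  then have "(mat_phi p (z \<cdot>\<^sub>m M) *\<^sub>v x) $ i = (\<Sum>j<n. x $ j * phi_series p (\<lambda>k. (M ^\<^sub>m k) $$ (i, j)) z)"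
    by (simp add: mult_mat_vec_index[OF phi x i] mult_ac)
  also have "\<dots> = phi_series p (\<lambda>k. \<Sum>j<n. x $ j * (M ^\<^sub>m k) $$ (i, j)) z"
    by (rule phi_series_sum[symmetric]) (use E in auto)
  also have "(\<lambda>k. \<Sum>j<n. x $ j * (M ^\<^sub>m k) $$ (i, j)) = (\<lambda>k. ((M ^\<^sub>m k) *\<^sub>v x) $ i)"
    by (rule ext) (simp add: mult_mat_vec_index[OF Mk x i] mult_ac)
  finally show ?thesis .
qed

lemma cscalar_prod_index:
  "y \<in> carrier_vec n \<Longrightarrow> x \<bullet>c y = (\<Sum>i<n. x $ i * cnj (y $ i))"
  by (auto simp: scalar_prod_def lessThan_atLeast0 intro!: sum.cong)

lemma last_first_eq:
  assumes "M \<in> carrier_mat m m" "0 < m"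
  shows "last_first m M = (M *\<^sub>v unit_vec m 0) $ (m - 1)"
proof -
  have "last_first m M = (\<Sum>i<m. (M *\<^sub>v unit_vec m 0) $ i * cnj (unit_vec m (m - 1) $ i))"
    unfolding last_first_def by (rule cscalar_prod_index) simp
  also have "\<dots> = (\<Sum>i<m. if i = m - 1 then (M *\<^sub>v unit_vec m 0) $ i else 0)"
    by (rule sum.cong) (auto simp: unit_vec_def)
  finally show ?thesis using assms by simp
qed

lemma mat_phi_carrier: "M \<in> carrier_mat n n \<Longrightarrow> mat_phi p (z \<cdot>\<^sub>m M) \<in> carrier_mat n n"
  by (simp add: mat_phi_def mat_power_series_def)

lemma last_first_mat_phi:
  assumes "B \<in> carrier_mat m m" "0 < m"
  shows "last_first m (mat_phi p (z \<cdot>\<^sub>m B)) = phi_series p (\<lambda>k. ((B ^\<^sub>m k) *\<^sub>v unit_vec m 0) $ (m - 1)) z"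
  using last_first_eq[OF mat_phi_carrier[OF assms(1)] assms(2)]
    mat_phi_mult_vec_index[OF assms(1), of "unit_vec m 0" "m - 1"] assms(2) by simp

lemma last_first_mat_phi_has_derivative:
  assumes "B \<in> carrier_mat m m" "0 < m"
  shows "((\<lambda>s. s ^ Suc p * Re (last_first m (mat_phi (Suc p) (complex_of_real s \<cdot>\<^sub>m B))))
    has_real_derivative s ^ p * Re (last_first m (mat_phi p (complex_of_real s \<cdot>\<^sub>m B)))) (at s)"
proof -
  let ?b = "\<lambda>k. ((B ^\<^sub>m k) *\<^sub>v unit_vec m 0) $ (m - 1)"
  have "geom_bounded ?b" by (rule geom_bounded_pow_mat_vec[OF assms(1)]) (use assms in auto)
  from has_field_derivative_Re[OF has_vector_derivative_real_field[OF phi_series_has_derivative[OF this]]]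
  have "((\<lambda>s. Re (complex_of_real s ^ Suc p * phi_series (Suc p) ?b (complex_of_real s)))
    has_real_derivative Re (complex_of_real s ^ p * phi_series p ?b (complex_of_real s))) (at s)" .
  moreover have "Re (complex_of_real s ^ k * z) = s ^ k * Re z" for s k z
    by (simp flip: of_real_power)
  ultimately show ?thesis
    unfolding last_first_mat_phi[OF assms] by simp
qed

section \<open>Positivity for tridiagonal matrices\<close>

text \<open>
  The Cauchy product with the exponential series. For \<open>u k\<close> an entry of \<open>M\<^sup>k x\<close> it yields the Taylor coefficients
  of that entry of \<open>exp(t (M + c I)) x = exp(ct) exp(tM) x\<close> without forming the shifted matrix.
\<close>

lemma exp_mult_phi_series:
  fixes u :: "nat \<Rightarrow> 'a::{real_normed_field, banach}"
  assumes "geom_bounded u"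
  shows "(\<lambda>k. (\<Sum>j\<le>k. (u j / fact j) * (c ^ (k - j) / fact (k - j))) * t ^ k)
    sums (exp (c * t) * phi_series 0 u t)"
proof -
  have c: "geom_bounded (\<lambda>k. c ^ k)"
    unfolding geom_bounded_def by (rule exI[of _ 1], rule exI[of _ "norm c"]) (simp add: norm_power)
  have "exp (c * t) = phi_series 0 (\<lambda>k. c ^ k) t"
    by (simp add: exp_def phi_series_def power_mult_distrib divide_inverse scaleR_conv_of_real mult.commute)
  moreover have "(\<lambda>k. \<Sum>j\<le>k. (u j * t ^ j / fact (j + 0)) * (c ^ (k - j) * t ^ (k - j) / fact (k - j + 0)))
      sums (phi_series 0 u t * phi_series 0 (\<lambda>k. c ^ k) t)"
    unfolding phi_series_def
    by (rule Cauchy_product_sums[OF phi_series_summable_norm[OF assms] phi_series_summable_norm[OF c]])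
  moreover have "(\<Sum>j\<le>k. (u j * t ^ j / fact (j + 0)) * (c ^ (k - j) * t ^ (k - j) / fact (k - j + 0)))
      = (\<Sum>j\<le>k. (u j / fact j) * (c ^ (k - j) / fact (k - j))) * t ^ k" for k
    unfolding sum_distrib_right
  proof (rule sum.cong[OF refl])
    fix j assume "j \<in> {..k}"
    then have "t ^ k = t ^ j * t ^ (k - j)" by (simp add: power_add[symmetric])
    then show "(u j * t ^ j / fact (j + 0)) * (c ^ (k - j) * t ^ (k - j) / fact (k - j + 0))
        = (u j / fact j) * (c ^ (k - j) / fact (k - j)) * t ^ k"
      by simp
  qed
  ultimately show ?thesis by (simp add: mult.commute)
qed

text \<open>
  The coefficient of \<open>t\<^sup>k\<close> in the product rule \<open>(exp(ct) f)' = c exp(ct) f + exp(ct) f'\<close>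
  for \<open>f(t) = \<Sum>j. u j t\<^sup>j / j!\<close>.
  Splitting \<open>k + 1\<close> as \<open>(k + 1 - j) + j\<close> avoids binomial coefficients: each half cancels one factorial.
\<close>

lemma shifted_coefficient_Suc:
  fixes u :: "nat \<Rightarrow> 'a::field_char_0"
  shows "of_nat (Suc k) * (\<Sum>j\<le>Suc k. (u j / fact j) * (c ^ (Suc k - j) / fact (Suc k - j)))
    = c * (\<Sum>j\<le>k. (u j / fact j) * (c ^ (k - j) / fact (k - j)))
      + (\<Sum>j\<le>k. (u (Suc j) / fact j) * (c ^ (k - j) / fact (k - j)))"
proof -
  let ?f = "\<lambda>j. (u j / fact j) * (c ^ (Suc k - j) / fact (Suc k - j))"
  have "of_nat (Suc k) * (\<Sum>j\<le>Suc k. ?f j) = (\<Sum>j\<le>Suc k. of_nat (Suc k - j) * ?f j + of_nat j * ?f j)"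
    unfolding sum_distrib_left
  proof (rule sum.cong[OF refl])
    fix j assume "j \<in> {..Suc k}"
    then have "of_nat (Suc k) = (of_nat (Suc k - j) + of_nat j :: 'a)"
      by (metis atMost_iff le_add_diff_inverse2 of_nat_add)
    then show "of_nat (Suc k) * ?f j = of_nat (Suc k - j) * ?f j + of_nat j * ?f j"
      by (simp only: distrib_right)
  qed
  also have "\<dots> = (\<Sum>j\<le>Suc k. of_nat (Suc k - j) * ?f j) + (\<Sum>j\<le>Suc k. of_nat j * ?f j)"
    by (rule sum.distrib)
  also have "(\<Sum>j\<le>Suc k. of_nat (Suc k - j) * ?f j) = (\<Sum>j\<le>k. of_nat (Suc k - j) * ?f j)"
    by (simp only: sum.atMost_Suc diff_self_eq_0 of_nat_0 mult_zero_left add_0_right)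
  also have "\<dots> = c * (\<Sum>j\<le>k. (u j / fact j) * (c ^ (k - j) / fact (k - j)))"
    unfolding sum_distrib_left
  proof (rule sum.cong[OF refl])
    fix j assume "j \<in> {..k}"
    then have j: "Suc k - j = Suc (k - j)" by (simp add: Suc_diff_le)
    have "of_nat (Suc (k - j)) \<noteq> (0::'a)" by (simp only: of_nat_eq_0_iff)
    then show "of_nat (Suc k - j) * ?f j = c * ((u j / fact j) * (c ^ (k - j) / fact (k - j)))"
      unfolding j fact_Suc by (simp del: of_nat_Suc add: field_simps)
  qed
  also have "(\<Sum>j\<le>Suc k. of_nat j * ?f j) = (\<Sum>j\<le>k. of_nat (Suc j) * ?f (Suc j))"
    by (simp only: sum.atMost_Suc_shift of_nat_0 mult_zero_left add_0_left)
  also have "\<dots> = (\<Sum>j\<le>k. (u (Suc j) / fact j) * (c ^ (k - j) / fact (k - j)))"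
  proof (rule sum.cong[OF refl])
    fix j
    have "of_nat (Suc j) \<noteq> (0::'a)" by (simp only: of_nat_eq_0_iff)
    then show "of_nat (Suc j) * ?f (Suc j) = (u (Suc j) / fact j) * (c ^ (k - j) / fact (k - j))"
      unfolding fact_Suc by (simp del: of_nat_Suc)
  qed
  finally show ?thesis .
qed

text \<open>
  Here \<open>u i k\<close> is the entry \<open>(i, 0)\<close> of \<open>R\<^sup>k\<close>. Adding \<open>c\<close> to the diagonal makes \<open>R\<close> nonnegative, and the
  Taylor coefficients \<open>a i k\<close> of \<open>exp(ct) exp(tR)\<close> obey a recursion with that nonnegative matrix. The
  subdiagonal carries the initial 1 in row 0 down by one row per step, so row \<open>m - 1\<close> has a
  positive coefficient at \<open>k = m - 1\<close>.
\<close>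

lemma phi_series_last_entry_pos:
  fixes R :: "nat \<Rightarrow> nat \<Rightarrow> real" and u :: "nat \<Rightarrow> nat \<Rightarrow> real"
  assumes m: "0 < m"
    and off_diag: "\<And>i j. i < m \<Longrightarrow> j < m \<Longrightarrow> i \<noteq> j \<Longrightarrow> 0 \<le> R i j"
    and sub_diag: "\<And>j. Suc j < m \<Longrightarrow> 0 < R (Suc j) j"
    and u0: "\<And>i. i < m \<Longrightarrow> u i 0 = (if i = 0 then 1 else 0)"
    and u_Suc: "\<And>i k. i < m \<Longrightarrow> u i (Suc k) = (\<Sum>l<m. R i l * u l k)"
    and u: "geom_bounded (u (m - 1))"
    and t: "0 < t"
  shows "0 < phi_series 0 (u (m - 1)) t"
proof -
  \<comment> \<open>Any bound for the diagonal entries serves as the shift.\<close>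
  define c where "c = (\<Sum>i<m. \<bar>R i i\<bar>)"
  define S where "S i l = R i l + (if i = l then c else 0)" for i l
  define a where "a i k = (\<Sum>j\<le>k. (u i j / fact j) * (c ^ (k - j) / fact (k - j)))" for i k
  have c: "\<bar>R i i\<bar> \<le> c" if "i < m" for i
    unfolding c_def by (rule member_le_sum) (use that in auto)
  have S: "0 \<le> S i l" if "i < m" "l < m" for i l
    using off_diag[OF that] c[OF that(1)] by (cases "i = l") (auto simp: S_def)
  have a_Suc: "real (Suc k) * a i (Suc k) = (\<Sum>l<m. S i l * a l k)" if i: "i < m" for i k
  proof -
    have "(\<Sum>j\<le>k. (u i (Suc j) / fact j) * (c ^ (k - j) / fact (k - j))) =
        (\<Sum>j\<le>k. \<Sum>l<m. R i l * ((u l j / fact j) * (c ^ (k - j) / fact (k - j))))"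
      by (simp add: u_Suc[OF i] sum_distrib_right sum_divide_distrib mult.assoc)
    also have "\<dots> = (\<Sum>l<m. R i l * a l k)"
      by (subst sum.swap) (simp add: a_def sum_distrib_left)
    finally have "real (Suc k) * a i (Suc k) = c * a i k + (\<Sum>l<m. R i l * a l k)"
      unfolding a_def shifted_coefficient_Suc by simp
    moreover have "(\<Sum>l<m. S i l * a l k) = (\<Sum>l<m. R i l * a l k) + (\<Sum>l<m. if i = l then c * a l k else 0)"
      unfolding sum.distrib[symmetric] by (rule sum.cong) (auto simp: S_def distrib_right)
    ultimately show ?thesis using i by simp
  qed
  have a_nonneg: "\<forall>i<m. 0 \<le> a i k" for k
  proof (induction k)
    case (Suc k)
    show ?case
    proof (intro allI impI)
      fix i assume i: "i < m"
      have "0 \<le> real (Suc k) * a i (Suc k)"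
        unfolding a_Suc[OF i] by (rule sum_nonneg) (use S i Suc in auto)
      then show "0 \<le> a i (Suc k)" by (simp add: zero_le_mult_iff)
    qed
  qed (simp add: a_def u0)
  have a_pos: "k < m \<Longrightarrow> 0 < a k k" for k
  proof (induction k)
    case (Suc k)
    have "0 < S (Suc k) k * a k k"
      using Suc sub_diag[of k] by (simp add: S_def)
    also have "\<dots> \<le> (\<Sum>l<m. S (Suc k) l * a l k)"
      by (rule member_le_sum[of k _ "\<lambda>l. S (Suc k) l * a l k"]) (use S a_nonneg[of k] Suc in auto)
    finally show ?case
      unfolding a_Suc[OF Suc.prems, symmetric] by (simp add: zero_less_mult_iff)
  qed (use m in \<open>simp add: a_def u0\<close>)
  have sums: "(\<lambda>k. a (m - 1) k * t ^ k) sums (exp (c * t) * phi_series 0 (u (m - 1)) t)"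
    using exp_mult_phi_series[OF u, of c t] by (simp only: a_def)
  have "0 < (\<Sum>k. a (m - 1) k * t ^ k)"
    by (rule suminf_pos2[where i = "m - 1", OF sums_summable[OF sums]])
      (use a_nonneg a_pos[of "m - 1"] m t in auto)
  then show ?thesis unfolding sums_unique[OF sums, symmetric] by (simp add: zero_less_mult_iff)
qed

lemma pow_mat_unit_vec_real:
  fixes T :: "complex mat"
  assumes T: "T \<in> carrier_mat m m"
    and real: "\<And>i j. i < m \<Longrightarrow> j < m \<Longrightarrow> T $$ (i, j) \<in> \<real>"
    and i: "i < m"
  shows "((T ^\<^sub>m k) *\<^sub>v unit_vec m 0) $ i \<in> \<real>"
  using i
proof (induction k arbitrary: i)
  case 0
  then show ?case using T by (simp add: unit_vec_def)
next
  case (Suc k)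
  have "(T ^\<^sub>m k) *\<^sub>v unit_vec m 0 \<in> carrier_vec m"
    by (rule mult_mat_vec_carrier[OF pow_carrier_mat[OF T]]) simp
  then show ?case
    unfolding pow_mat_Suc_mult_vec[OF T unit_vec_carrier]
    using Suc real by (subst mult_mat_vec_index[OF T]) (auto intro!: sum_in_Reals Reals_mult)
qed

text \<open>
  Since \<open>T\<close> is real, the first columns of its powers are real and follow the recursion of
  \<open>phi_series_last_entry_pos\<close>.
\<close>

lemma last_first_mat_phi_0_pos:
  assumes T: "T \<in> carrier_mat m m" and m: "0 < m"
    and real: "\<And>i j. i < m \<Longrightarrow> j < m \<Longrightarrow> T $$ (i, j) \<in> \<real>"
    and off_diag: "\<And>i j. i < m \<Longrightarrow> j < m \<Longrightarrow> i \<noteq> j \<Longrightarrow> 0 \<le> T $$ (i, j)"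
    and sub_diag: "\<And>j. j + 1 < m \<Longrightarrow> 0 < T $$ (j + 1, j)"
    and t: "0 < t"
  shows "0 < last_first m (mat_phi 0 (complex_of_real t \<cdot>\<^sub>m T))"
proof -
  define x where "x k = (T ^\<^sub>m k) *\<^sub>v unit_vec m 0" for k
  define u where "u i k = Re (x k $ i)" for i k
  have x: "x k \<in> carrier_vec m" for k
    unfolding x_def by (rule mult_mat_vec_carrier[OF pow_carrier_mat[OF T]]) simp
  have xu: "x k $ i = complex_of_real (u i k)" if "i < m" for i k
    using pow_mat_unit_vec_real[OF T real that] unfolding u_def x_def by (simp add: of_real_Re)
  have "geom_bounded (\<lambda>k. x k $ (m - 1))"
    unfolding x_def by (rule geom_bounded_pow_mat_vec[OF T]) (use m in auto)
  then have e: "geom_bounded (u (m - 1))" using m by (simp add: geom_bounded_def xu)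
  have "0 < phi_series 0 (u (m - 1)) t"
  proof (rule phi_series_last_entry_pos[where R = "\<lambda>i j. Re (T $$ (i, j))" and m = m, OF m])
    show "0 \<le> Re (T $$ (i, j))" if "i < m" "j < m" "i \<noteq> j" for i j
      using off_diag[OF that] by (simp add: less_eq_complex_def)
    show "0 < Re (T $$ (Suc j, j))" if "Suc j < m" for j
      using sub_diag[of j] that by (simp add: less_complex_def)
    show "u i 0 = (if i = 0 then 1 else 0)" if "i < m" for i
      using T that m by (simp add: u_def x_def unit_vec_def)
    show "u i (Suc k) = (\<Sum>l<m. Re (T $$ (i, l)) * u l k)" if i: "i < m" for i k
    proof -
      have "x (Suc k) $ i = (\<Sum>l<m. T $$ (i, l) * x k $ l)"
        using mult_mat_vec_index[OF T x i] unfolding x_def pow_mat_Suc_mult_vec[OF T unit_vec_carrier] .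
      then have "u i (Suc k) = (\<Sum>l<m. Re (T $$ (i, l) * complex_of_real (u l k)))"
        unfolding u_def[of i] by (simp add: xu)
      then show ?thesis by simp
    qed
  qed (rule e, rule t)
  moreover have "last_first m (mat_phi 0 (complex_of_real t \<cdot>\<^sub>m T)) = complex_of_real (phi_series 0 (u (m - 1)) t)"
    unfolding last_first_mat_phi[OF T m] phi_series_of_real[OF e, symmetric] x_def[symmetric]
    using m by (simp add: xu)
  ultimately show ?thesis by (simp add: less_complex_def)
qed

text \<open>
  Each function \<open>t\<^bsup>p+1\<^esup> e\<^sub>m\<^sup>* \<phi>\<^bsub>p+1\<^esub>(tB) e\<close> vanishes at 0 and has its predecessor as derivative, so nonnegativity
  passes from \<open>p\<close> to \<open>p + 1\<close>. At \<open>t = 0\<close> itself the scaling says nothing; there the value is the matrix entry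
  of \<open>I / p!\<close>.
\<close>

lemma last_first_mat_phi_nonneg:
  assumes B: "B \<in> carrier_mat m m" and m: "0 < m"
    and real: "\<And>k. ((B ^\<^sub>m k) *\<^sub>v unit_vec m 0) $ (m - 1) \<in> \<real>"
    and pos: "\<And>s. 0 < s \<Longrightarrow> 0 \<le> last_first m (mat_phi 0 (complex_of_real s \<cdot>\<^sub>m B))"
    and t: "0 \<le> t"
  shows "0 \<le> last_first m (mat_phi p (complex_of_real t \<cdot>\<^sub>m B))"
proof -
  define L where "L q s = last_first m (mat_phi q (complex_of_real s \<cdot>\<^sub>m B))" for q s
  define c where "c k = Re (((B ^\<^sub>m k) *\<^sub>v unit_vec m 0) $ (m - 1))" for k
  have cc: "(\<lambda>k. ((B ^\<^sub>m k) *\<^sub>v unit_vec m 0) $ (m - 1)) = (\<lambda>k. complex_of_real (c k))"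
    unfolding c_def using real by (simp add: of_real_Re)
  have "geom_bounded (\<lambda>k. complex_of_real (c k))"
    unfolding cc[symmetric] by (rule geom_bounded_pow_mat_vec[OF B]) (use m in auto)
  then have "geom_bounded c" by (simp add: geom_bounded_def)
  then have L: "L q s = complex_of_real (phi_series q c s)" for q s
    unfolding L_def last_first_mat_phi[OF B m] cc by (rule phi_series_of_real)
  have at0: "0 \<le> Re (L q 0)" for q
    unfolding L Re_complex_of_real phi_series_0 using B m by (simp add: c_def unit_vec_def)
  have "0 \<le> Re (L p s)" if "0 \<le> s" for s
    using that
  proof (induction p arbitrary: s)
    case 0
    then show ?case
      using pos[of s] at0[of 0] by (cases "s = 0") (auto simp: L_def less_eq_complex_def)
  next
    case (Suc p)
    show ?case
    proof (cases "s = 0")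
      case False
      have "0 ^ Suc p * Re (L (Suc p) 0) \<le> s ^ Suc p * Re (L (Suc p) s)"
      proof (rule DERIV_nonneg_imp_nondecreasing[OF Suc.prems], intro exI conjI)
        fix q assume "0 \<le> q" "q \<le> s"
        show "((\<lambda>s. s ^ Suc p * Re (L (Suc p) s)) has_real_derivative q ^ p * Re (L p q)) (at q)"
          unfolding L_def by (rule last_first_mat_phi_has_derivative[OF B m])
        show "0 \<le> q ^ p * Re (L p q)" using Suc.IH \<open>0 \<le> q\<close> by simp
      qed
      moreover have "0 < s ^ Suc p" using False Suc.prems by (intro zero_less_power) simp
      ultimately show ?thesis by (simp add: zero_le_mult_iff del: power_Suc)
    qed (use at0 in simp)
  qed
  from this[OF t] show ?thesis
    unfolding L_def[symmetric] by (simp add: L less_eq_complex_def)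
qed

section \<open>Logarithmic norm and dissipativity\<close>

lemma vec_norm2_nonneg: "0 \<le> vec_norm2 x"
  by (simp add: vec_norm2_def)

lemma vec_norm2_add_le:
  assumes "x \<in> carrier_vec n" "y \<in> carrier_vec n"
  shows "vec_norm2 (x + y) \<le> vec_norm2 x + vec_norm2 y"
proof -
  have "vec_norm2 (x + y) \<le> L2_set (\<lambda>i. cmod (x $ i) + cmod (y $ i)) {..<n}"
    unfolding vec_norm2_def using assms by (auto intro!: L2_set_mono norm_triangle_ineq)
  also have "\<dots> \<le> vec_norm2 x + vec_norm2 y"
    unfolding vec_norm2_def using assms L2_set_triangle_ineq[of "\<lambda>i. cmod (x $ i)" "\<lambda>i. cmod (y $ i)" "{..<n}"] by auto
  finally show ?thesis .
qed

lemma vec_norm2_smult: "vec_norm2 (a \<cdot>\<^sub>v x) = cmod a * vec_norm2 x"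
  unfolding vec_norm2_def
  by (subst L2_set_right_distrib) (auto simp: norm_mult intro!: L2_set_cong)

lemma vec_norm2_square:
  "(vec_norm2 x)\<^sup>2 = (\<Sum>i<dim_vec x. (cmod (x $ i))\<^sup>2)"
  by (simp add: vec_norm2_def L2_set_def sum_nonneg)

lemma cmod_cscalar_prod_le:
  assumes "x \<in> carrier_vec n" "y \<in> carrier_vec n"
  shows "cmod (x \<bullet>c y) \<le> vec_norm2 x * vec_norm2 y"
proof -
  have "cmod (x \<bullet>c y) \<le> (\<Sum>i<n. \<bar>cmod (x $ i)\<bar> * \<bar>cmod (y $ i)\<bar>)"
    unfolding cscalar_prod_index[OF assms(2)] by (rule order_trans[OF norm_sum]) (simp add: norm_mult)
  also have "\<dots> \<le> vec_norm2 x * vec_norm2 y"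
    unfolding vec_norm2_def using assms L2_set_mult_ineq[of "\<lambda>i. cmod (x $ i)" "\<lambda>i. cmod (y $ i)" "{..<n}"] by auto
  finally show ?thesis .
qed

lemma cscalar_prod_self:
  assumes "x \<in> carrier_vec n"
  shows "x \<bullet>c x = complex_of_real ((vec_norm2 x)\<^sup>2)"
  unfolding cscalar_prod_index[OF assms] vec_norm2_square
  using assms by (simp add: of_real_sum complex_norm_square del: of_real_power)

lemma vec_norm2_mult_bdd:
  assumes M: "M \<in> carrier_mat n n"
  shows "bdd_above ((\<lambda>x. vec_norm2 (M *\<^sub>v x)) ` {x \<in> carrier_vec (dim_col M). vec_norm2 x \<le> 1})"
proof -
  define B where "B = (\<Sum>i<n. \<Sum>j<n. cmod (M $$ (i, j)))"
  have "vec_norm2 (M *\<^sub>v x) \<le> B" if x: "x \<in> carrier_vec n" and x1: "vec_norm2 x \<le> 1" for x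
  proof -
    have xj: "cmod (x $ j) \<le> 1" if "j < n" for j
      using member_le_L2_set[of "{..<n}" j "\<lambda>i. cmod (x $ i)"] that x x1 by (simp add: vec_norm2_def)
    have "vec_norm2 (M *\<^sub>v x) \<le> (\<Sum>i<n. cmod ((M *\<^sub>v x) $ i))"
      unfolding vec_norm2_def using M L2_set_le_sum[of "{..<n}" "\<lambda>i. cmod ((M *\<^sub>v x) $ i)"] by simp
    also have "\<dots> \<le> B"
      unfolding B_def
    proof (rule sum_mono)
      fix i assume "i \<in> {..<n}"
      then have "(M *\<^sub>v x) $ i = (\<Sum>j<n. M $$ (i, j) * x $ j)"
        using mult_mat_vec_index[OF M x] by simp
      also have "cmod \<dots> \<le> (\<Sum>j<n. cmod (M $$ (i, j)))"
        by (rule order_trans[OF norm_sum], rule sum_mono) (use xj in \<open>simp add: norm_mult mult_left_le\<close>)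
      finally show "cmod ((M *\<^sub>v x) $ i) \<le> (\<Sum>j<n. cmod (M $$ (i, j)))" .
    qed
    finally show ?thesis .
  qed
  then show ?thesis using M by (intro bdd_aboveI[of _ B]) auto
qed

lemma vec_norm2_mult_le_mat_norm2:
  assumes "M \<in> carrier_mat n n" "x \<in> carrier_vec n" "vec_norm2 x \<le> 1"
  shows "vec_norm2 (M *\<^sub>v x) \<le> mat_norm2 M"
  unfolding mat_norm2_def
  by (rule cSUP_upper) (use assms vec_norm2_mult_bdd in \<open>auto\<close>)

lemma shifted_identity_mult_vec:
  fixes A :: "complex mat"
  assumes A: "A \<in> carrier_mat n n" and x: "x \<in> carrier_vec n"
  shows "(1\<^sub>m (dim_row A) + h \<cdot>\<^sub>m A) *\<^sub>v x = x + h \<cdot>\<^sub>v (A *\<^sub>v x)"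
proof -
  have "(1\<^sub>m n + h \<cdot>\<^sub>m A) *\<^sub>v x = 1\<^sub>m n *\<^sub>v x + (h \<cdot>\<^sub>m A) *\<^sub>v x"
    by (rule add_mult_distrib_mat_vec[of _ n n]) (use A x in auto)
  also have "(h \<cdot>\<^sub>m A) *\<^sub>v x = h \<cdot>\<^sub>v (A *\<^sub>v x)"
    by (rule eq_vecI) (use A x in auto)
  finally show ?thesis using A x by simp
qed

text \<open>
  Convexity of \<open>h \<mapsto> \<parallel>I + h A\<parallel>\<close> along the ray from \<open>I\<close>, where the norm is at most 1:
  \<open>I + h A = (1 - l) I + l (I + k A)\<close> with \<open>l = h / k\<close>.
\<close>

lemma log_norm2_quotient_mono:
  fixes A :: "complex mat"
  defines "N \<equiv> \<lambda>h. mat_norm2 (1\<^sub>m (dim_row A) + complex_of_real h \<cdot>\<^sub>m A)"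
  assumes A: "A \<in> carrier_mat n n" and h: "0 < h" "h \<le> k"
  shows "(N h - 1) / h \<le> (N k - 1) / k"
proof -
  define l where "l = h / k"
  have l: "0 < l" "l \<le> 1" "h = l * k" and k: "0 < k" using h by (auto simp: l_def)
  have "N h \<le> (1 - l) + l * N k"
    unfolding N_def mat_norm2_def[of "1\<^sub>m (dim_row A) + complex_of_real h \<cdot>\<^sub>m A"]
  proof (rule cSUP_least)
    have "0\<^sub>v n \<in> {x \<in> carrier_vec n. vec_norm2 x \<le> 1}" by (simp add: vec_norm2_def L2_set_def)
    moreover have "dim_col (1\<^sub>m (dim_row A) + complex_of_real h \<cdot>\<^sub>m A) = n" using A by simp
    ultimately show "{x \<in> carrier_vec (dim_col (1\<^sub>m (dim_row A) + complex_of_real h \<cdot>\<^sub>m A)). vec_norm2 x \<le> 1} \<noteq> {}"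
      by blast
  next
    fix x :: "complex Matrix.vec"
    assume "x \<in> {x \<in> carrier_vec (dim_col (1\<^sub>m (dim_row A) + complex_of_real h \<cdot>\<^sub>m A)). vec_norm2 x \<le> 1}"
    then have x: "x \<in> carrier_vec n" "vec_norm2 x \<le> 1" using A by auto
    let ?y = "x + complex_of_real k \<cdot>\<^sub>v (A *\<^sub>v x)"
    have y: "?y \<in> carrier_vec n" using A x by simp
    have "x + complex_of_real h \<cdot>\<^sub>v (A *\<^sub>v x) = complex_of_real (1 - l) \<cdot>\<^sub>v x + complex_of_real l \<cdot>\<^sub>v ?y"
      by (rule eq_vecI) (use A x in \<open>auto simp: l(3) algebra_simps\<close>)
    then have "vec_norm2 (x + complex_of_real h \<cdot>\<^sub>v (A *\<^sub>v x)) \<le> (1 - l) * vec_norm2 x + l * vec_norm2 ?y"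
      using vec_norm2_add_le[of "complex_of_real (1 - l) \<cdot>\<^sub>v x" n "complex_of_real l \<cdot>\<^sub>v ?y"] x y l
      by (simp add: vec_norm2_smult del: of_real_diff)
    also have "\<dots> \<le> (1 - l) * 1 + l * N k"
    proof (intro add_mono mult_left_mono)
      show "vec_norm2 ?y \<le> N k"
        unfolding N_def shifted_identity_mult_vec[OF A x(1), symmetric]
        by (rule vec_norm2_mult_le_mat_norm2[of _ n]) (use A x in auto)
    qed (use l x in auto)
    finally show "vec_norm2 ((1\<^sub>m (dim_row A) + complex_of_real h \<cdot>\<^sub>m A) *\<^sub>v x) \<le> (1 - l) +
        l * mat_norm2 (1\<^sub>m (dim_row A) + complex_of_real k \<cdot>\<^sub>m A)"
      unfolding shifted_identity_mult_vec[OF A x(1)] N_def by simp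
  qed
  then have "N h - 1 \<le> l * (N k - 1)" by (simp add: algebra_simps)
  then have "(N h - 1) / h \<le> l * (N k - 1) / h"
    using h by (intro divide_right_mono) auto
  also have "\<dots> = (N k - 1) / k" using l k by simp
  finally show ?thesis .
qed

lemma tendsto_at_right_mono_bounded:
  fixes q :: "real \<Rightarrow> real"
  assumes mono: "\<And>h k. 0 < h \<Longrightarrow> h \<le> k \<Longrightarrow> q h \<le> q k" and bound: "\<And>h. 0 < h \<Longrightarrow> b \<le> q h"
  obtains l where "(q \<longlongrightarrow> l) (at_right 0)" "b \<le> l"
proof
  let ?l = "Inf (q ` {0<..})"
  have bdd: "bdd_below (q ` {0<..})" by (rule bdd_belowI[of _ b]) (auto intro: bound)
  show "b \<le> ?l" by (rule cInf_greatest) (auto intro: bound)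
  show "(q \<longlongrightarrow> ?l) (at_right 0)"
  proof (rule order_tendstoI)
    fix a assume a: "a < ?l"
    have "a < q h" if "0 < h" for h
      using a cInf_lower[OF imageI bdd, of h] that by simp
    then show "eventually (\<lambda>h. a < q h) (at_right 0)"
      unfolding eventually_at_right_field by (intro exI[of _ 1]) simp
  next
    fix a assume "?l < a"
    then obtain k where k: "0 < k" "q k < a"
      using cInf_lessD[of "q ` {0<..}" a] by auto
    then have "q h < a" if "0 < h" "h < k" for h
      using mono[of h k] that by simp
    then show "eventually (\<lambda>h. q h < a) (at_right 0)"
      unfolding eventually_at_right_field using k(1) by (intro exI[of _ k]) simp
  qed
qed

text \<open>
  For a unit vector \<open>u\<close> the Cauchy-Schwarz inequality gives
  \<open>1 + h Re(u\<^sup>* A u) = Re(u\<^sup>* (I + h A) u) \<le> \<parallel>I + h A\<parallel>\<close>, so every difference quotient, and hence their limit,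
  is at least \<open>Re(u\<^sup>* A u)\<close>. The same lower bound makes the monotone limit exist.
\<close>

lemma dissipative_if_log_norm2_nonpos:
  assumes A: "A \<in> carrier_mat n n" and neg: "log_norm2 A \<le> 0" and x: "x \<in> carrier_vec n"
  shows "Re ((A *\<^sub>v x) \<bullet>c x) \<le> 0"
proof (cases "vec_norm2 x = 0")
  case True
  then have "cmod ((A *\<^sub>v x) \<bullet>c x) \<le> 0"
    using cmod_cscalar_prod_le[of "A *\<^sub>v x" n x] A x by simp
  then show ?thesis by simp
next
  case False
  define q where "q h = (mat_norm2 (1\<^sub>m (dim_row A) + complex_of_real h \<cdot>\<^sub>m A) - 1) / h" for h
  define s where "s = vec_norm2 x"
  have s: "0 < s" using False vec_norm2_nonneg[of x] by (simp add: s_def)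
  define u where "u = complex_of_real (1 / s) \<cdot>\<^sub>v x"
  have u: "u \<in> carrier_vec n" "vec_norm2 u = 1"
    using x s by (auto simp: u_def vec_norm2_smult s_def[symmetric] simp del: of_real_divide)
  have Au: "A *\<^sub>v u \<in> carrier_vec n" using A u by simp
  have lower: "Re ((A *\<^sub>v u) \<bullet>c u) \<le> q h" if h: "0 < h" for h
  proof -
    have "Re ((u + complex_of_real h \<cdot>\<^sub>v (A *\<^sub>v u)) \<bullet>c u) = 1 + h * Re ((A *\<^sub>v u) \<bullet>c u)"
      using u Au cscalar_prod_self[OF u(1)]
      by (simp add: add_scalar_prod_distrib[of _ n] Re_complex_of_real)
    moreover have "Re ((u + complex_of_real h \<cdot>\<^sub>v (A *\<^sub>v u)) \<bullet>c u)
        \<le> vec_norm2 (u + complex_of_real h \<cdot>\<^sub>v (A *\<^sub>v u)) * vec_norm2 u"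
      by (rule order_trans[OF complex_Re_le_cmod cmod_cscalar_prod_le]) (use u Au in auto)
    moreover have "vec_norm2 (u + complex_of_real h \<cdot>\<^sub>v (A *\<^sub>v u))
        \<le> mat_norm2 (1\<^sub>m (dim_row A) + complex_of_real h \<cdot>\<^sub>m A)"
      unfolding shifted_identity_mult_vec[OF A u(1), symmetric]
      by (rule vec_norm2_mult_le_mat_norm2[of _ n]) (use A u in auto)
    ultimately show ?thesis using h u(2) by (simp add: q_def field_simps)
  qed
  have mono: "q h \<le> q k" if "0 < h" "h \<le> k" for h k
    unfolding q_def by (rule log_norm2_quotient_mono[OF A that])
  obtain l where l: "(q \<longlongrightarrow> l) (at_right 0)" "Re ((A *\<^sub>v u) \<bullet>c u) \<le> l"
    using tendsto_at_right_mono_bounded[of q, OF mono lower] by blast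
  have "log_norm2 A = l"
    unfolding log_norm2_def using l(1)
    by (intro tendsto_Lim) (auto simp: q_def[abs_def])
  then have "Re ((A *\<^sub>v u) \<bullet>c u) \<le> 0" using l(2) neg by simp
  moreover have "x = complex_of_real s \<cdot>\<^sub>v u"
    using s by (simp add: u_def smult_smult_assoc)
  then have "(A *\<^sub>v x) \<bullet>c x = complex_of_real (s\<^sup>2) * ((A *\<^sub>v u) \<bullet>c u)"
    using A u Au by (simp add: mult_mat_vec[OF A] conjugate_smult_vec power2_eq_square)
  ultimately show ?thesis using s by (simp add: mult_nonneg_nonpos)
qed

section \<open>The error as a forced dissipative flow\<close>

text \<open>
  From \<open>(\<parallel>y\<parallel>\<^sup>2)' = 2 Re(y\<^sup>* y') \<le> 2 d \<parallel>g\<parallel> \<parallel>y\<parallel>\<close> one would conclude \<open>\<parallel>y\<parallel>' \<le> d \<parallel>g\<parallel>\<close>, but the norm is not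
  differentiable where \<open>y\<close> vanishes, and \<open>y\<close> starts at 0. The smooth substitute
  \<open>sqrt(\<parallel>y\<parallel>\<^sup>2 + \<epsilon>\<^sup>2)\<close> obeys the same inequality and costs \<open>\<epsilon>\<close> at time 0.
\<close>

lemma norm_growth_bound:
  fixes y y' :: "real \<Rightarrow> complex Matrix.vec" and d D :: "real \<Rightarrow> real"
  assumes A: "A \<in> carrier_mat n n"
    and dissipative: "\<And>x. x \<in> carrier_vec n \<Longrightarrow> Re ((A *\<^sub>v x) \<bullet>c x) \<le> 0"
    and g: "g \<in> carrier_vec n"
    and y: "\<And>s. y s \<in> carrier_vec n"
    and deriv: "\<And>i s. i < n \<Longrightarrow> 0 \<le> s \<Longrightarrow> ((\<lambda>s. y s $ i) has_vector_derivative
      (A *\<^sub>v y s) $ i + complex_of_real (d s) * g $ i) (at s)"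
    and D: "\<And>s. (D has_real_derivative d s) (at s)"
    and d: "\<And>s. 0 \<le> s \<Longrightarrow> 0 \<le> d s"
    and init: "y 0 = 0\<^sub>v n" "D 0 = 0"
    and t: "0 \<le> t"
  shows "vec_norm2 (y t) \<le> vec_norm2 g * D t"
proof (rule field_le_epsilon)
  fix e :: real assume e: "0 < e"
  define N where "N s = (\<Sum>i<n. (Re (y s $ i))\<^sup>2 + (Im (y s $ i))\<^sup>2) + e\<^sup>2" for s
  define N' where "N' s = (\<Sum>i<n. 2 * Re (((A *\<^sub>v y s) $ i + complex_of_real (d s) * g $ i) * cnj (y s $ i)))" for s
  define f where "f s = sqrt (N s) - vec_norm2 g * D s" for s
  have N: "N s = (vec_norm2 (y s))\<^sup>2 + e\<^sup>2" for s
    unfolding N_def vec_norm2_square using y[of s] by (simp add: cmod_power2)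
  have Npos: "0 < N s" and sqrtN: "vec_norm2 (y s) \<le> sqrt (N s)" for s
    using e by (auto simp: N add_nonneg_pos intro!: real_le_rsqrt)
  have dN: "(N has_real_derivative N' s) (at s)" if "0 \<le> s" for s
    unfolding N_def[abs_def] N'_def
    by (rule derivative_eq_intros refl has_field_derivative_Re has_field_derivative_Im deriv that | simp)+
  have N'_le: "N' s \<le> 2 * (d s * (vec_norm2 g * sqrt (N s)))" if s: "0 \<le> s" for s
  proof -
    have "N' s = 2 * Re ((A *\<^sub>v y s) \<bullet>c y s) + 2 * (d s * Re (g \<bullet>c y s))"
      unfolding N'_def cscalar_prod_index[OF y]
      by (simp add: sum_distrib_left distrib_right sum.distrib mult.assoc flip: sum_distrib_left)
    also have "\<dots> \<le> 0 + 2 * (d s * (vec_norm2 g * sqrt (N s)))"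
    proof -
      have "Re (g \<bullet>c y s) \<le> vec_norm2 g * vec_norm2 (y s)"
        by (rule order_trans[OF complex_Re_le_cmod cmod_cscalar_prod_le[OF g y]])
      also have "\<dots> \<le> vec_norm2 g * sqrt (N s)"
        by (rule mult_left_mono[OF sqrtN vec_norm2_nonneg])
      finally have "d s * Re (g \<bullet>c y s) \<le> d s * (vec_norm2 g * sqrt (N s))"
        by (rule mult_left_mono[OF _ d[OF s]])
      then show ?thesis using dissipative[OF y, of s] by linarith
    qed
    finally show ?thesis by simp
  qed
  have "f t \<le> f 0"
  proof (rule DERIV_nonpos_imp_nonincreasing[OF t], intro exI conjI)
    fix s assume s: "0 \<le> s" "s \<le> t"
    show "DERIV f s :> N' s * (inverse (sqrt (N s)) / 2) - vec_norm2 g * d s"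
      unfolding f_def[abs_def]
      unfolding mult.commute[of "N' s"]
      by (rule DERIV_diff[OF DERIV_chain2[OF DERIV_real_sqrt[OF Npos] dN[OF s(1)]] DERIV_cmult[OF D]])
    have "N' s * (inverse (sqrt (N s)) / 2) \<le> 2 * (d s * (vec_norm2 g * sqrt (N s))) * (inverse (sqrt (N s)) / 2)"
      by (rule mult_right_mono[OF N'_le[OF s(1)]]) (use Npos[of s] in simp)
    also have "\<dots> = vec_norm2 g * d s"
      using Npos[of s] by (simp add: field_simps)
    finally show "N' s * (inverse (sqrt (N s)) / 2) - vec_norm2 g * d s \<le> 0" by simp
  qed
  moreover have "f 0 = e" using e by (simp add: f_def N init vec_norm2_def L2_set_def)
  ultimately show "vec_norm2 (y t) \<le> vec_norm2 g * D t + e"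
    using sqrtN[of t] by (simp add: f_def)
qed

text \<open>
  The sequence \<open>r j = A\<^sup>j v - W B\<^sup>j e\<close> starts at 0 and, by the Krylov relation, satisfies \<open>r (j+1) = A (r j) + b\<^sub>j g\<close>
  with \<open>b\<^sub>j\<close> the last component of \<open>B\<^sup>j e\<close>. Summing it into a phi series gives the forced linear
  equation for the error scaled by \<open>t\<^sup>p\<close>, with the \<open>p\<close>-th defect as forcing; its antiderivative is the defect of
  index \<open>p + 1\<close>. The relation is assumed for a general \<open>W\<close>, \<open>B\<close>, \<open>g\<close> since the plain and the corrected
  approximation are both instances.
\<close>

lemma krylov_error_bound:
  fixes A B W :: "complex mat"
  assumes A: "A \<in> carrier_mat n n" and B: "B \<in> carrier_mat k k" and W: "W \<in> carrier_mat n k"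
    and k: "0 < k" and v: "v \<in> carrier_vec n" and g: "g \<in> carrier_vec n"
    and dissipative: "\<And>x. x \<in> carrier_vec n \<Longrightarrow> Re ((A *\<^sub>v x) \<bullet>c x) \<le> 0"
    and start: "W *\<^sub>v unit_vec k 0 = v"
    and krylov: "\<And>x. x \<in> carrier_vec k \<Longrightarrow> A *\<^sub>v (W *\<^sub>v x) = W *\<^sub>v (B *\<^sub>v x) + x $ (k - 1) \<cdot>\<^sub>v g"
    and nonneg: "\<And>s. 0 \<le> s \<Longrightarrow> 0 \<le> last_first k (mat_phi p (complex_of_real s \<cdot>\<^sub>m B))"
    and t: "0 \<le> t"
  shows "vec_norm2 (krylov_error p k A v W B t) \<le>
    vec_norm2 g * (t * Re (last_first k (mat_phi (Suc p) (complex_of_real t \<cdot>\<^sub>m B))))"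
proof -
  define x where "x j = (B ^\<^sub>m j) *\<^sub>v unit_vec k 0" for j
  define r where "r j = (A ^\<^sub>m j) *\<^sub>v v - W *\<^sub>v x j" for j
  define L where "L q s = last_first k (mat_phi q (complex_of_real s \<cdot>\<^sub>m B))" for q s
  have x: "x j \<in> carrier_vec k" for j
    unfolding x_def by (rule mult_mat_vec_carrier[OF pow_carrier_mat[OF B]]) simp
  have Av: "(A ^\<^sub>m j) *\<^sub>v v \<in> carrier_vec n" for j
    by (rule mult_mat_vec_carrier[OF pow_carrier_mat[OF A] v])
  have Wx: "W *\<^sub>v x j \<in> carrier_vec n" for j by (rule mult_mat_vec_carrier[OF W x])
  have r: "r j \<in> carrier_vec n" for j unfolding r_def using Av Wx by simp
  have r0: "r 0 = 0\<^sub>v n"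
    unfolding r_def x_def using A B v by (simp add: start)
  have r_Suc: "r (Suc j) = A *\<^sub>v r j + x j $ (k - 1) \<cdot>\<^sub>v g" for j
  proof -
    have "A *\<^sub>v r j = A *\<^sub>v ((A ^\<^sub>m j) *\<^sub>v v) - A *\<^sub>v (W *\<^sub>v x j)"
      unfolding r_def by (rule mult_minus_distrib_mat_vec[OF A Av Wx])
    also have "\<dots> = (A ^\<^sub>m Suc j) *\<^sub>v v - (W *\<^sub>v x (Suc j) + x j $ (k - 1) \<cdot>\<^sub>v g)"
      unfolding krylov[OF x] pow_mat_Suc_mult_vec[OF A v]
      unfolding x_def pow_mat_Suc_mult_vec[OF B unit_vec_carrier] ..
    finally have "A *\<^sub>v r j = (A ^\<^sub>m Suc j) *\<^sub>v v - (W *\<^sub>v x (Suc j) + x j $ (k - 1) \<cdot>\<^sub>v g)" .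
    moreover have cancel: "a - b = a - (b + c) + c"
      if "a \<in> carrier_vec n" "b \<in> carrier_vec n" "c \<in> carrier_vec n" for a b c :: "complex Matrix.vec"
      using that by (intro eq_vecI) auto
    ultimately show ?thesis
      unfolding r_def[of "Suc j"]
      using cancel[OF Av[of "Suc j"] Wx[of "Suc j"] smult_carrier_vec[THEN iffD2, OF g], of "x j $ (k - 1)"]
      by (simp only:)
  qed
  have ex: "geom_bounded (\<lambda>j. x j $ l)" if "l < k" for l
    unfolding x_def by (rule geom_bounded_pow_mat_vec[OF B unit_vec_carrier that])
  have eA: "geom_bounded (\<lambda>j. ((A ^\<^sub>m j) *\<^sub>v v) $ i)" if "i < n" for i
    by (rule geom_bounded_pow_mat_vec[OF A v that])
  have Wx_i: "(W *\<^sub>v x j) $ i = (\<Sum>l<k. W $$ (i, l) * x j $ l)" if "i < n" for i j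
    by (rule mult_mat_vec_index[OF W x that])
  have eW: "geom_bounded (\<lambda>j. \<Sum>l<k. W $$ (i, l) * x j $ l)" for i
    by (rule geom_bounded_sum) (use ex in auto)
  have r_i: "(\<lambda>j. r j $ i) = (\<lambda>j. ((A ^\<^sub>m j) *\<^sub>v v) $ i + (-1) * (\<Sum>l<k. W $$ (i, l) * x j $ l))"
    if "i < n" for i
    unfolding r_def using that Av Wx Wx_i[OF that] W A by (intro ext) simp
  have er: "geom_bounded (\<lambda>j. r j $ i)" if "i < n" for i
    unfolding r_i[OF that] by (rule geom_bounded_add[OF eA[OF that] geom_bounded_mult_left[OF eW]])
  have phi_r: "krylov_error p k A v W B s $ i = phi_series p (\<lambda>j. r j $ i) (complex_of_real s)"
    if i: "i < n" for i s
  proof -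
    let ?z = "complex_of_real s"
    let ?w = "mat_phi p (?z \<cdot>\<^sub>m B) *\<^sub>v unit_vec k 0"
    have w: "?w \<in> carrier_vec k" by (rule mult_mat_vec_carrier[OF mat_phi_carrier[OF B]]) simp
    have "(W *\<^sub>v ?w) $ i = (\<Sum>l<k. W $$ (i, l) * phi_series p (\<lambda>j. x j $ l) ?z)"
      unfolding mult_mat_vec_index[OF W w i] x_def
      by (intro sum.cong refl) (simp add: mat_phi_mult_vec_index[OF B unit_vec_carrier])
    also have "\<dots> = phi_series p (\<lambda>j. \<Sum>l<k. W $$ (i, l) * x j $ l) ?z"
      by (rule phi_series_sum[symmetric]) (use ex in auto)
    finally have "krylov_error p k A v W B s $ i = phi_series p (\<lambda>j. ((A ^\<^sub>m j) *\<^sub>v v) $ i) ?z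
        - phi_series p (\<lambda>j. \<Sum>l<k. W $$ (i, l) * x j $ l) ?z"
      unfolding krylov_error_def using mat_phi_mult_vec_index[OF A v i] W i by simp
    also have "\<dots> = phi_series p (\<lambda>j. r j $ i) ?z"
      unfolding r_i[OF i] phi_series_add[OF eA[OF i] geom_bounded_mult_left[OF eW]] phi_series_mult_left[OF eW]
      by simp
    finally show ?thesis .
  qed
  have err: "krylov_error p k A v W B s \<in> carrier_vec n" for s
    using W unfolding krylov_error_def by (intro carrier_vecI) simp
  define y where "y s = complex_of_real (s ^ p) \<cdot>\<^sub>v krylov_error p k A v W B s" for s
  have y: "y s \<in> carrier_vec n" for s unfolding y_def using err by simp
  have y_i: "y s $ i = complex_of_real s ^ p * phi_series p (\<lambda>j. r j $ i) (complex_of_real s)" if "i < n" for i s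
    unfolding y_def using err[of s] phi_r[OF that] that by simp
  have deriv: "((\<lambda>s. y s $ i) has_vector_derivative
      (A *\<^sub>v y s) $ i + complex_of_real (s ^ p * Re (L p s)) * g $ i) (at s)"
    if i: "i < n" and s: "0 \<le> s" for i s
  proof -
    let ?z = "complex_of_real s"
    have b: "phi_series p (\<lambda>j. x j $ (k - 1)) ?z = complex_of_real (Re (L p s))"
      using nonneg[OF s] k unfolding L_def x_def last_first_mat_phi[OF B k]
      by (simp add: less_eq_complex_def complex_eq_iff)
    have "(\<lambda>j. r (Suc j) $ i) = (\<lambda>j. (\<Sum>l<n. A $$ (i, l) * r j $ l) + g $ i * x j $ (k - 1))"
      unfolding r_Suc using mult_mat_vec_index[OF A r i] g i A by (intro ext) simp
    moreover have "geom_bounded (\<lambda>j. \<Sum>l<n. A $$ (i, l) * r j $ l)"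
      by (rule geom_bounded_sum) (use er in auto)
    moreover have "phi_series p (\<lambda>j. \<Sum>l<n. A $$ (i, l) * r j $ l) ?z =
        (\<Sum>l<n. A $$ (i, l) * phi_series p (\<lambda>j. r j $ l) ?z)"
      by (rule phi_series_sum) (use er in auto)
    moreover have xk: "geom_bounded (\<lambda>j. x j $ (k - 1))" by (rule ex) (use k in simp)
    ultimately have "phi_series p (\<lambda>j. r (Suc j) $ i) ?z =
        (\<Sum>l<n. A $$ (i, l) * phi_series p (\<lambda>j. r j $ l) ?z) + g $ i * complex_of_real (Re (L p s))"
      by (simp only: phi_series_add[OF _ geom_bounded_mult_left[OF xk]] phi_series_mult_left[OF xk] b)
    then have "?z ^ p * phi_series p (\<lambda>j. r (Suc j) $ i) ?z =
        (A *\<^sub>v y s) $ i + complex_of_real (s ^ p * Re (L p s)) * g $ i"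
      unfolding mult_mat_vec_index[OF A y i]
      by (simp add: y_i distrib_left sum_distrib_left mult_ac)
    moreover have "((\<lambda>s. y s $ i) has_vector_derivative ?z ^ p * phi_series p (\<lambda>j. r (Suc j) $ i) ?z) (at s)"
      unfolding y_i[OF i]
      by (rule has_vector_derivative_real_field[OF phi_series_derivative_rec[OF er[OF i]]]) (use r0 i in simp)
    ultimately show ?thesis by simp
  qed
  have "vec_norm2 (y t) \<le> vec_norm2 g * (t ^ Suc p * Re (L (Suc p) t))"
  proof (rule norm_growth_bound[OF A dissipative g y deriv _ _ _ _ t])
    show "((\<lambda>s. s ^ Suc p * Re (L (Suc p) s)) has_real_derivative s ^ p * Re (L p s)) (at s)" for s
      unfolding L_def by (rule last_first_mat_phi_has_derivative[OF B k])
    show "0 \<le> s ^ p * Re (L p s)" if "0 \<le> s" for s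
      using nonneg[OF that] that by (simp add: L_def less_eq_complex_def)
    show "y 0 = 0\<^sub>v n"
      using y[of 0] r0 by (intro eq_vecI) (auto simp: y_i phi_series_0)
  qed simp_all
  then have *: "t ^ p * vec_norm2 (krylov_error p k A v W B t) \<le> t ^ p * (vec_norm2 g * (t * Re (L (Suc p) t)))"
    unfolding y_def vec_norm2_smult using t by (simp add: mult_ac norm_power)
  show ?thesis
  \<comment> \<open>Cancelling the scaling factor needs a positive time; at time 0 the error itself is zero.\<close>
  proof (cases "t = 0")
    case True
    have "krylov_error p k A v W B 0 = 0\<^sub>v n"
      using err[of 0] r0 by (intro eq_vecI) (auto simp: phi_r phi_series_0)
    then show ?thesis using True by (simp add: vec_norm2_def L2_set_def)
  next
    case False
    then show ?thesis using * t by (simp add: L_def)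
  qed
qed

section \<open>The Lanczos decomposition and its extension\<close>

lemma extended_T_carrier: "T \<in> carrier_mat m m \<Longrightarrow> extended_T m T \<tau> \<in> carrier_mat (m + 1) (m + 1)"
  unfolding extended_T_def by (rule four_block_carrier_mat) auto

lemma extended_T_mult_append:
  assumes T: "T \<in> carrier_mat m m" and m: "0 < m" and x: "x \<in> carrier_vec m" and a: "a \<in> carrier_vec 1"
  shows "extended_T m T \<tau> *\<^sub>v (x @\<^sub>v a) = (T *\<^sub>v x) @\<^sub>v vec 1 (\<lambda>_. complex_of_real \<tau> * x $ (m - 1))"
proof -
  let ?R = "mat_of_rows m [unit_vec m (m - 1)] :: complex mat"
  have R: "?R \<in> carrier_mat 1 m" by (simp add: mat_of_rows_def)
  have "(complex_of_real \<tau> \<cdot>\<^sub>m ?R *\<^sub>v x) $ 0 = (\<Sum>j<m. (complex_of_real \<tau> \<cdot>\<^sub>m ?R) $$ (0, j) * x $ j)"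
    by (rule mult_mat_vec_index[OF _ x]) (use R in auto)
  also have "\<dots> = (\<Sum>j<m. if j = m - 1 then complex_of_real \<tau> * x $ j else 0)"
    by (rule sum.cong) (auto simp: mat_of_rows_def unit_vec_def)
  also have "\<dots> = complex_of_real \<tau> * x $ (m - 1)" using m by simp
  finally have last: "(complex_of_real \<tau> \<cdot>\<^sub>m ?R *\<^sub>v x) $ 0 = complex_of_real \<tau> * x $ (m - 1)" .
  have "extended_T m T \<tau> *\<^sub>v (x @\<^sub>v a) = (T *\<^sub>v x + 0\<^sub>m m 1 *\<^sub>v a) @\<^sub>v (complex_of_real \<tau> \<cdot>\<^sub>m ?R *\<^sub>v x + 0\<^sub>m 1 1 *\<^sub>v a)"
    unfolding extended_T_def by (rule four_block_mat_mult_vec[OF T _ _ _ x a]) (use R in auto)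
  also have "0\<^sub>m m 1 *\<^sub>v a = 0\<^sub>v m" using a by (intro eq_vecI) (auto simp: scalar_prod_def)
  also have "0\<^sub>m 1 1 *\<^sub>v a = 0\<^sub>v 1" using a by (intro eq_vecI) (auto simp: scalar_prod_def)
  also have "T *\<^sub>v x + 0\<^sub>v m = T *\<^sub>v x" using mult_mat_vec_carrier[OF T x] by simp
  also have "complex_of_real \<tau> \<cdot>\<^sub>m ?R *\<^sub>v x + 0\<^sub>v 1 = vec 1 (\<lambda>_. complex_of_real \<tau> * x $ (m - 1))"
    by (rule eq_vecI) (use last R in \<open>auto simp del: index_mult_mat_vec\<close>)
  finally show ?thesis .
qed

text \<open>
  The last column of \<open>T\<^sup>+\<close> is zero, so the upper block of \<open>(T\<^sup>+)\<^sup>k e\<close> is \<open>T\<^sup>k e\<close>, and its last component is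
  \<open>\<tau>\<close> times the last component of \<open>T\<^bsup>k-1\<^esup> e\<close> (and 0 for \<open>k = 0\<close>). A phi series whose coefficients are delayed
  by one is \<open>z\<close> times the next phi series.
\<close>

lemma last_first_phi_extended_T:
  assumes T: "T \<in> carrier_mat m m" and m: "0 < m"
  shows "last_first (m + 1) (mat_phi p (z \<cdot>\<^sub>m extended_T m T \<tau>)) =
    complex_of_real \<tau> * z * last_first m (mat_phi (Suc p) (z \<cdot>\<^sub>m T))"
proof -
  let ?P = "extended_T m T \<tau>"
  define x where "x k = (T ^\<^sub>m k) *\<^sub>v unit_vec m 0" for k
  define b where "b k = x k $ (m - 1)" for k
  define c where "c k = (case k of 0 \<Rightarrow> 0 | Suc j \<Rightarrow> complex_of_real \<tau> * b j)" for k
  have P: "?P \<in> carrier_mat (m + 1) (m + 1)" by (rule extended_T_carrier[OF T])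
  have x: "x k \<in> carrier_vec m" for k
    unfolding x_def by (rule mult_mat_vec_carrier[OF pow_carrier_mat[OF T]]) simp
  have pow: "(?P ^\<^sub>m k) *\<^sub>v unit_vec (m + 1) 0 = x k @\<^sub>v vec 1 (\<lambda>_. c k)" for k
  proof (induction k)
    case 0
    have "(?P ^\<^sub>m 0) *\<^sub>v unit_vec (m + 1) 0 = unit_vec (m + 1) 0" using P by simp
    also have "unit_vec (m + 1) 0 = x 0 @\<^sub>v vec 1 (\<lambda>_. c 0)"
      using m T by (intro eq_vecI) (auto simp: x_def c_def unit_vec_def)
    finally show ?case .
  next
    case (Suc k)
    have "(?P ^\<^sub>m Suc k) *\<^sub>v unit_vec (m + 1) 0 = ?P *\<^sub>v (x k @\<^sub>v vec 1 (\<lambda>_. c k))"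
      unfolding pow_mat_Suc_mult_vec[OF P unit_vec_carrier] Suc ..
    also have "\<dots> = (T *\<^sub>v x k) @\<^sub>v vec 1 (\<lambda>_. complex_of_real \<tau> * x k $ (m - 1))"
      by (rule extended_T_mult_append[OF T m x]) simp
    also have "T *\<^sub>v x k = x (Suc k)"
      unfolding x_def pow_mat_Suc_mult_vec[OF T unit_vec_carrier] ..
    finally show ?case by (simp add: c_def b_def)
  qed
  have ck: "(\<lambda>k. ((?P ^\<^sub>m k) *\<^sub>v unit_vec (m + 1) 0) $ (m + 1 - 1)) = c"
    unfolding pow using carrier_vecD[OF x] by (intro ext) simp
  have ec: "geom_bounded c"
    unfolding ck[symmetric] by (rule geom_bounded_pow_mat_vec[OF P]) auto
  have eb: "geom_bounded b"
    unfolding b_def x_def by (rule geom_bounded_pow_mat_vec[OF T]) (use m in auto)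
  have "last_first (m + 1) (mat_phi p (z \<cdot>\<^sub>m ?P)) = phi_series p c z"
    using last_first_mat_phi[OF P, of p z] unfolding ck by simp
  also have "\<dots> = z * phi_series (Suc p) (\<lambda>k. complex_of_real \<tau> * b k) z"
    unfolding phi_series_unfold[OF ec] by (simp add: c_def)
  also have "\<dots> = complex_of_real \<tau> * z * phi_series (Suc p) b z"
    unfolding phi_series_mult_left[OF eb] by simp
  also have "phi_series (Suc p) b z = last_first m (mat_phi (Suc p) (z \<cdot>\<^sub>m T))"
    unfolding last_first_mat_phi[OF T m] b_def x_def ..
  finally show ?thesis .
qed

lemma lanczos_relation:
  assumes A: "A \<in> carrier_mat n n" and V: "V \<in> carrier_mat n m" and T: "T \<in> carrier_mat m m"
    and w: "w \<in> carrier_vec n" and m: "0 < m" and x: "x \<in> carrier_vec m"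
    and rel: "A * V = V * T + complex_of_real \<tau> \<cdot>\<^sub>m (mat_of_cols n [w] * mat_of_rows m [unit_vec m (m - 1)])"
  shows "A *\<^sub>v (V *\<^sub>v x) = V *\<^sub>v (T *\<^sub>v x) + x $ (m - 1) \<cdot>\<^sub>v (complex_of_real \<tau> \<cdot>\<^sub>v w)"
proof -
  define E where "E = complex_of_real \<tau> \<cdot>\<^sub>m (mat_of_cols n [w] * mat_of_rows m [unit_vec m (m - 1)])"
  have E: "E \<in> carrier_mat n m" unfolding E_def by (intro smult_carrier_mat mult_carrier_mat[of _ n 1]) auto
  have E_ij: "E $$ (i, j) = complex_of_real \<tau> * (w $ i * unit_vec m (m - 1) $ j)" if "i < n" "j < m" for i j
    using that by (simp add: E_def scalar_prod_def mat_of_cols_def mat_of_rows_def)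
  have "A *\<^sub>v (V *\<^sub>v x) = (V * T + E) *\<^sub>v x"
    using assoc_mult_mat_vec[OF A V x, unfolded rel, folded E_def] by (rule sym)
  also have "\<dots> = (V * T) *\<^sub>v x + E *\<^sub>v x"
    by (rule add_mult_distrib_mat_vec[OF mult_carrier_mat[OF V T] E x])
  also have "(V * T) *\<^sub>v x = V *\<^sub>v (T *\<^sub>v x)"
    by (rule assoc_mult_mat_vec[OF V T x])
  also have "E *\<^sub>v x = x $ (m - 1) \<cdot>\<^sub>v (complex_of_real \<tau> \<cdot>\<^sub>v w)"
  proof (rule eq_vecI)
    fix i assume "i < dim_vec (x $ (m - 1) \<cdot>\<^sub>v (complex_of_real \<tau> \<cdot>\<^sub>v w))"
    then have i: "i < n" using w by simp
    have "(E *\<^sub>v x) $ i = (\<Sum>j<m. if j = m - 1 then complex_of_real \<tau> * w $ i * x $ j else 0)"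
      unfolding mult_mat_vec_index[OF E x i] by (rule sum.cong) (auto simp: E_ij i unit_vec_def)
    then show "(E *\<^sub>v x) $ i = (x $ (m - 1) \<cdot>\<^sub>v (complex_of_real \<tau> \<cdot>\<^sub>v w)) $ i"
      using m i w by simp
  qed (use E w in simp)
  finally show ?thesis .
qed

lemma extended_V_carrier: "V \<in> carrier_mat n m \<Longrightarrow> extended_V n V w \<in> carrier_mat n (m + 1)"
  unfolding extended_V_def by auto

lemma extended_V_mult_append:
  assumes V: "V \<in> carrier_mat n m" and w: "w \<in> carrier_vec n" and x: "x \<in> carrier_vec m" and a: "a \<in> carrier_vec 1"
  shows "extended_V n V w *\<^sub>v (x @\<^sub>v a) = V *\<^sub>v x + a $ 0 \<cdot>\<^sub>v w"
proof (rule eq_vecI)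
  fix i assume "i < dim_vec (V *\<^sub>v x + a $ 0 \<cdot>\<^sub>v w)"
  then have i: "i < n" using w by simp
  have xa: "x @\<^sub>v a \<in> carrier_vec (m + 1)" by (rule append_carrier_vec[OF x a])
  have ij: "extended_V n V w $$ (i, j) = (if j < m then V $$ (i, j) else w $ i)" if "j < m + 1" for j
    using that V i by (auto simp: extended_V_def mat_of_cols_index nth_append)
  have "(extended_V n V w *\<^sub>v (x @\<^sub>v a)) $ i =
      (\<Sum>j<m + 1. (if j < m then V $$ (i, j) else w $ i) * (x @\<^sub>v a) $ j)"
    unfolding mult_mat_vec_index[OF extended_V_carrier[OF V] xa i] by (rule sum.cong) (auto simp: ij)
  also have "\<dots> = (\<Sum>j<m. V $$ (i, j) * x $ j) + w $ i * a $ 0"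
    using carrier_vecD[OF x] carrier_vecD[OF a] by simp
  finally show "(extended_V n V w *\<^sub>v (x @\<^sub>v a)) $ i = (V *\<^sub>v x + a $ 0 \<cdot>\<^sub>v w) $ i"
    using mult_mat_vec_index[OF V x i] V w i by (simp del: index_mult_mat_vec)
qed (use V w extended_V_carrier[OF V, of w] in auto)

text \<open>
  The last row of \<open>T\<^sup>+\<close> absorbs the residual \<open>\<tau> w e\<^sub>m\<^sup>*\<close> of the plain relation; since the last column of \<open>T\<^sup>+\<close>
  is zero, the image \<open>A w\<close> of the new basis vector becomes the new residual.
\<close>

lemma extended_lanczos_relation:
  assumes A: "A \<in> carrier_mat n n" and V: "V \<in> carrier_mat n m" and T: "T \<in> carrier_mat m m"
    and w: "w \<in> carrier_vec n" and m: "0 < m" and x: "x \<in> carrier_vec (m + 1)"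
    and rel: "\<And>y. y \<in> carrier_vec m \<Longrightarrow>
      A *\<^sub>v (V *\<^sub>v y) = V *\<^sub>v (T *\<^sub>v y) + y $ (m - 1) \<cdot>\<^sub>v (complex_of_real \<tau> \<cdot>\<^sub>v w)"
  shows "A *\<^sub>v (extended_V n V w *\<^sub>v x) =
    extended_V n V w *\<^sub>v (extended_T m T \<tau> *\<^sub>v x) + x $ (m + 1 - 1) \<cdot>\<^sub>v (A *\<^sub>v w)"
proof -
  define y where "y = vec_first x m"
  define a where "a = vec_last x 1"
  have xya: "x = y @\<^sub>v a" unfolding y_def a_def using vec_first_last_append[OF x] by simp
  have y: "y \<in> carrier_vec m" and a: "a \<in> carrier_vec 1" by (auto simp: y_def a_def)
  have Ty: "T *\<^sub>v y \<in> carrier_vec m" by (rule mult_mat_vec_carrier[OF T y])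
  have xm: "x $ (m + 1 - 1) = a $ 0" using carrier_vecD[OF y] carrier_vecD[OF a] unfolding xya by simp
  have "A *\<^sub>v (extended_V n V w *\<^sub>v x) = A *\<^sub>v (V *\<^sub>v y) + a $ 0 \<cdot>\<^sub>v (A *\<^sub>v w)"
    unfolding xya extended_V_mult_append[OF V w y a]
    using mult_mat_vec_carrier[OF V y] w
    by (simp only: mult_add_distrib_mat_vec[OF A] smult_carrier_vec mult_mat_vec[OF A w])
  moreover have "extended_V n V w *\<^sub>v (extended_T m T \<tau> *\<^sub>v x) =
      V *\<^sub>v (T *\<^sub>v y) + (complex_of_real \<tau> * y $ (m - 1)) \<cdot>\<^sub>v w"
    unfolding xya extended_T_mult_append[OF T m y a]
    by (subst extended_V_mult_append[OF V w Ty]) auto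
  moreover have "(complex_of_real \<tau> * y $ (m - 1)) \<cdot>\<^sub>v w = y $ (m - 1) \<cdot>\<^sub>v (complex_of_real \<tau> \<cdot>\<^sub>v w)"
    by (simp add: smult_smult_assoc mult.commute)
  ultimately show ?thesis unfolding xm rel[OF y] by simp
qed

section \<open>The error bounds\<close>

theorem proposition6:
  fixes n m :: nat
    and A V T :: "complex mat"
    and v w :: "complex Matrix.vec"
    and \<tau> :: real
  assumes "A \<in> carrier_mat n n"
    and "v \<in> carrier_vec n"
    and "vec_norm2 v = 1"
    and "m \<ge> 1"
    and "mat_adjoint A = A"
    and "log_norm2 A \<le> 0"
    and "lanczos_decomposition n m A v V T \<tau> w"
  shows "(\<forall>t::real. t > 0 \<longrightarrow>
            complex_of_real (cmod (krylov_defect m T t)) = krylov_defect m T t \<and>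
            0 < krylov_defect m T t) \<and>
         (\<forall>(p::nat) (t::real). t \<ge> 0 \<longrightarrow>
            complex_of_real (vec_norm2 (krylov_error p m A v V T t))
              \<le> complex_of_real (\<tau> * t) *
                 last_first m (mat_phi (p + 1) (complex_of_real t \<cdot>\<^sub>m T)) \<and>
            0 \<le> last_first m (mat_phi (p + 1) (complex_of_real t \<cdot>\<^sub>m T)) \<and>
            complex_of_real (vec_norm2 (corrected_krylov_error p n m A v V T \<tau> w t))
              \<le> complex_of_real (vec_norm2 (A *\<^sub>v w) * \<tau> * t\<^sup>2) *
                 last_first m (mat_phi (p + 2) (complex_of_real t \<cdot>\<^sub>m T)) \<and>
            0 \<le> last_first m (mat_phi (p + 2) (complex_of_real t \<cdot>\<^sub>m T)))"
proof -
  note A = assms(1) and v = assms(2)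
  have m: "0 < m" using assms(4) by simp
  have V: "V \<in> carrier_mat n m" and T: "T \<in> carrier_mat m m" and w: "w \<in> carrier_vec n"
    and start: "V *\<^sub>v unit_vec m 0 = v"
    and T_real: "\<And>i j. i < m \<Longrightarrow> j < m \<Longrightarrow> T $$ (i, j) \<in> \<real>"
    and T_sym: "transpose_mat T = T"
    and T_tridiag: "\<And>i j. i < m \<Longrightarrow> j < m \<Longrightarrow> i + 1 < j \<or> j + 1 < i \<Longrightarrow> T $$ (i, j) = 0"
    and T_sub: "\<And>j. j + 1 < m \<Longrightarrow> 0 < T $$ (j + 1, j)"
    and \<tau>: "0 < \<tau>" and w1: "vec_norm2 w = 1"
    and rel: "A * V = V * T + complex_of_real \<tau> \<cdot>\<^sub>m (mat_of_cols n [w] * mat_of_rows m [unit_vec m (m - 1)])"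
    using assms(7) unfolding lanczos_decomposition_def by blast+
  define L where "L q s = last_first m (mat_phi q (complex_of_real s \<cdot>\<^sub>m T))" for q s
  have off_diag: "0 \<le> T $$ (i, j)" if ij: "i < m" "j < m" "i \<noteq> j" for i j
  proof -
    consider "i = j + 1" | "j = i + 1" | "i + 1 < j \<or> j + 1 < i" using ij(3) by linarith
    then show ?thesis
    proof cases
      case 1
      then show ?thesis using T_sub[of j] ij by simp
    next
      case 2
      moreover have "T $$ (i, j) = T $$ (j, i)" using T_sym T ij by (metis index_transpose_mat(1) carrier_matD)
      ultimately show ?thesis using T_sub[of i] ij by simp
    next
      case 3
      then show ?thesis using T_tridiag[OF ij(1,2)] by simp
    qed
  qed
  have L0_pos: "0 < L 0 s" if "0 < s" for s
    unfolding L_def by (rule last_first_mat_phi_0_pos[OF T m T_real off_diag T_sub that])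
  have L_nonneg: "0 \<le> L q s" if "0 \<le> s" for q s
    unfolding L_def
  proof (rule last_first_mat_phi_nonneg[OF T m _ _ that])
    show "((T ^\<^sub>m k) *\<^sub>v unit_vec m 0) $ (m - 1) \<in> \<real>" for k
      by (rule pow_mat_unit_vec_real[OF T T_real]) (use m in auto)
    show "0 \<le> last_first m (mat_phi 0 (complex_of_real s \<cdot>\<^sub>m T))" if "0 < s" for s
      using L0_pos[OF that] by (simp add: L_def)
  qed
  have dissipative: "Re ((A *\<^sub>v x) \<bullet>c x) \<le> 0" if "x \<in> carrier_vec n" for x
    by (rule dissipative_if_log_norm2_nonpos[OF A assms(6) that])
  note V_rel = lanczos_relation[OF A V T w m _ rel]
  have defect: "krylov_defect m T t = L 0 t" for t
    by (simp add: krylov_defect_def L_def mat_exp_def mat_phi_def)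
  have plain: "vec_norm2 (krylov_error p m A v V T t) \<le> \<tau> * t * Re (L (p + 1) t)" if t: "0 \<le> t" for p t
  proof -
    have "vec_norm2 (krylov_error p m A v V T t) \<le>
        vec_norm2 (complex_of_real \<tau> \<cdot>\<^sub>v w) * (t * Re (L (Suc p) t))"
      unfolding L_def
      by (rule krylov_error_bound[OF A T V m v _ dissipative start V_rel _ t])
        (use w L_nonneg in \<open>auto simp: L_def\<close>)
    then show ?thesis using \<tau> w1 by (simp add: vec_norm2_smult)
  qed
  have corrected: "vec_norm2 (corrected_krylov_error p n m A v V T \<tau> w t)
      \<le> vec_norm2 (A *\<^sub>v w) * \<tau> * t\<^sup>2 * Re (L (p + 2) t)" if t: "0 \<le> t" for p t
  proof -
    let ?P = "extended_T m T \<tau>" and ?W = "extended_V n V w"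
    have P_L: "last_first (m + 1) (mat_phi q (complex_of_real s \<cdot>\<^sub>m ?P)) = complex_of_real (\<tau> * s) * L (Suc q) s" for q s
      unfolding last_first_phi_extended_T[OF T m] L_def by simp
    have "unit_vec (m + 1) 0 = unit_vec m 0 @\<^sub>v (0\<^sub>v 1 :: complex Matrix.vec)"
      using m by (intro eq_vecI) (auto simp: unit_vec_def)
    moreover have "0 \<cdot>\<^sub>v w = 0\<^sub>v n" using w by (intro eq_vecI) auto
    ultimately have W_start: "?W *\<^sub>v unit_vec (m + 1) 0 = v"
      using extended_V_mult_append[OF V w, of "unit_vec m 0" "0\<^sub>v 1"] start v w by simp
    have "vec_norm2 (krylov_error p (m + 1) A v ?W ?P t) \<le>
        vec_norm2 (A *\<^sub>v w) * (t * Re (last_first (m + 1) (mat_phi (Suc p) (complex_of_real t \<cdot>\<^sub>m ?P))))"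
    proof (rule krylov_error_bound[OF A extended_T_carrier[OF T] extended_V_carrier[OF V] _ v _ dissipative W_start _ _ t])
      show "A *\<^sub>v w \<in> carrier_vec n" by (rule mult_mat_vec_carrier[OF A w])
      show "A *\<^sub>v (?W *\<^sub>v x) = ?W *\<^sub>v (?P *\<^sub>v x) + x $ (m + 1 - 1) \<cdot>\<^sub>v (A *\<^sub>v w)"
        if "x \<in> carrier_vec (m + 1)" for x
        by (rule extended_lanczos_relation[OF A V T w m that V_rel])
      show "0 \<le> last_first (m + 1) (mat_phi p (complex_of_real s \<cdot>\<^sub>m ?P))" if "0 \<le> s" for s
        unfolding P_L using L_nonneg[OF that, of "Suc p"] \<tau> that by (simp add: less_eq_complex_def)
    qed simp
    then show ?thesis
      unfolding corrected_krylov_error_def P_L by (simp add: power2_eq_square mult_ac)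
  qed
  show ?thesis
  proof (intro conjI allI impI)
    fix t :: real assume t: "0 < t"
    show "0 < krylov_defect m T t" unfolding defect by (rule L0_pos[OF t])
    then show "complex_of_real (cmod (krylov_defect m T t)) = krylov_defect m T t"
      by (auto simp: less_complex_def complex_eq_iff cmod_eq_Re)
  next
    fix p :: nat and t :: real assume t: "0 \<le> t"
    have real: "L q t = complex_of_real (Re (L q t))" for q
      using L_nonneg[OF t, of q] by (simp add: less_eq_complex_def complex_eq_iff)
    show "0 \<le> last_first m (mat_phi (p + 1) (complex_of_real t \<cdot>\<^sub>m T))"
      and "0 \<le> last_first m (mat_phi (p + 2) (complex_of_real t \<cdot>\<^sub>m T))"
      using L_nonneg[OF t] unfolding L_def by blast+
    show "complex_of_real (vec_norm2 (krylov_error p m A v V T t))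
        \<le> complex_of_real (\<tau> * t) * last_first m (mat_phi (p + 1) (complex_of_real t \<cdot>\<^sub>m T))"
      using plain[OF t, of p] unfolding L_def[symmetric] 
      by (subst real) (simp add: less_eq_complex_def)
    show "complex_of_real (vec_norm2 (corrected_krylov_error p n m A v V T \<tau> w t))
        \<le> complex_of_real (vec_norm2 (A *\<^sub>v w) * \<tau> * t\<^sup>2) *
          last_first m (mat_phi (p + 2) (complex_of_real t \<cdot>\<^sub>m T))"
      using corrected[OF t, of p] unfolding L_def[symmetric]
      by (subst real) (simp add: less_eq_complex_def)
  qed
qed

end
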